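(* Let $$E(x,y,z)=\sum_{n\ge0}\sum_{m\ge0}\sum_{t\ge0}\bigl|\mathcal{IS}_{n,t}^{(m)}(102,000)\bigr|\,z^ty^mx^n,$$ where $\mathcal{IS}_{n,t}^{(m)}(102,000)$ is the set of $(102,000)$-avoiding inversion sequences $e$ of length $n$ with $\operatorname{dist}(e)=m$ and $\operatorname{rank}(e)=t$. Then $E$ is algebraic over $\mathbb{Q}(x,y,z)$ with minimal polynomial (in the variable $T$) $$\begin{aligned} 1&-\bigl(1-2yx(1-x)z+y(1-x)^2(1-z)\bigr)T\\ &+y\bigl(2x^2z^2+x(1-x)(2z^2-6z+3)+yx^2(1-x)^2z^2+(1-x)^2(1-z)-yx(1-x)^3(1-z)\bigr)T^2\\ &+yx\bigl(2yx^2(1-x)z^3+xz(1-z)(4-z)-2yx(1-x)^2z(1-z)-2(1-x)(1-z)^2\bigr)T^3\\ &+yx^2\bigl(yx^2z^4-yx(1-x)z^2(1-z)+(1-z)^3\bigr)T^4 . \end{aligned}$$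
   Context: An inversion sequence of length $n$ is an integer sequence $e=(e_1,\dots,e_n)$ with $0\le e_j\le j-1$ for all $j$. It is $(102,000)$-avoiding if there are no indices $i<j<k$ with $e_j<e_i<e_k$ and no indices $i<j<k$ with $e_i=e_j=e_k$. $\operatorname{dist}(e)$ is the number of distinct entries of $e$. For such $e$ of length $n\ge1$, let $p$ be the position of the first descent, i.e. the least $p$ with $e_1\le e_2\le\dots\le e_p>e_{p+1}$, using the convention $e_{n+1}=-1$; then $\operatorname{rank}(e):=(p-1)-e_p\ge 0$. By convention, for $n=0$ the only sequence is the empty sequence, with $\operatorname{dist}=\operatorname{rank}=0$. *)

theory Defs
  imports "HOL-Computational_Algebra.Computational_Algebra"
begin

section \<open>Inversion sequences\<close>

text \<open>
  A sequence \<open>(e\<^sub>1, \<dots>, e\<^sub>n)\<close> is a list whose positions are counted from 0, so the bound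
  \<open>0 \<le> e\<^sub>j \<le> j - 1\<close> becomes \<open>e ! i \<le> i\<close>.
\<close>

definition inversion_seq :: "nat list \<Rightarrow> bool" where
  "inversion_seq e \<longleftrightarrow> (\<forall>i < length e. e ! i \<le> i)"

definition avoids_102 :: "nat list \<Rightarrow> bool" where
  "avoids_102 e \<longleftrightarrow>
     \<not> (\<exists>i j k. i < j \<and> j < k \<and> k < length e \<and> e ! j < e ! i \<and> e ! i < e ! k)"

definition avoids_000 :: "nat list \<Rightarrow> bool" where
  "avoids_000 e \<longleftrightarrow>
     \<not> (\<exists>i j k. i < j \<and> j < k \<and> k < length e \<and> e ! i = e ! j \<and> e ! j = e ! k)"

definition dist_entries :: "nat list \<Rightarrow> nat" where
  "dist_entries e = card (set e)"

text \<open>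
  For nonempty \<open>e\<close>, \<open>first_descent e\<close> is \<open>p - 1\<close>, where \<open>p\<close> is the position (counted from 1)
  of the first descent. By the convention \<open>e\<^sub>n\<^sub>+\<^sub>1 = -1\<close> the last position is always a descent.
\<close>

definition first_descent :: "nat list \<Rightarrow> nat" where
  "first_descent e =
     (LEAST i. i < length e \<and> (Suc i < length e \<longrightarrow> e ! Suc i < e ! i))"

text \<open>The subtraction does not truncate when \<open>e\<close> is an inversion sequence.\<close>

definition rank :: "nat list \<Rightarrow> nat" where
  "rank e = (if e = [] then 0 else first_descent e - e ! first_descent e)"

definition IS_102_000 :: "nat \<Rightarrow> nat \<Rightarrow> nat \<Rightarrow> nat list set" where
  "IS_102_000 n m t =
     {e. length e = n \<and> inversion_seq e \<and> avoids_102 e \<and> avoids_000 e \<and>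
         dist_entries e = m \<and> rank e = t}"


section \<open>The generating function\<close>

text \<open>
  The ring \<open>\<rat>[[x, y, z]]\<close> is represented by iterated power series: \<open>x\<close> is the outermost
  variable, then \<open>y\<close>, then \<open>z\<close>.
\<close>

type_synonym fps3 = "rat fps fps fps"

definition E_series :: fps3 where
  "E_series = Abs_fps (\<lambda>n. Abs_fps (\<lambda>m. Abs_fps (\<lambda>t. of_nat (card (IS_102_000 n m t)))))"

definition fract_of :: "'a :: idom \<Rightarrow> 'a fract" where
  "fract_of a = Fract a 1"

definition var_x :: "fps3 fract" where
  "var_x = fract_of fps_X"

definition var_y :: "fps3 fract" where
  "var_y = fract_of (fps_const fps_X)"

definition var_z :: "fps3 fract" where
  "var_z = fract_of (fps_const (fps_const fps_X))"


section \<open>Algebraic elements and minimal polynomials over a subfield\<close>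

text \<open>
  The least subfield containing \<open>S\<close>. In characteristic 0 it contains the rationals, so
  \<open>subfield_generated {var_x, var_y, var_z}\<close> is \<open>\<rat>(x, y, z)\<close> inside the fraction field of
  \<open>\<rat>[[x, y, z]]\<close>.
\<close>

inductive_set subfield_generated :: "'a :: field set \<Rightarrow> 'a set" for S where
  base: "a \<in> S \<Longrightarrow> a \<in> subfield_generated S"
| one: "1 \<in> subfield_generated S"
| diff: "a \<in> subfield_generated S \<Longrightarrow> b \<in> subfield_generated S \<Longrightarrow>
     a - b \<in> subfield_generated S"
| mult: "a \<in> subfield_generated S \<Longrightarrow> b \<in> subfield_generated S \<Longrightarrow>
     a * b \<in> subfield_generated S"
| inverse: "a \<in> subfield_generated S \<Longrightarrow> inverse a \<in> subfield_generated S"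

definition annihilating_polys :: "'a :: field set \<Rightarrow> 'a \<Rightarrow> 'a poly set" where
  "annihilating_polys K a = {p. p \<noteq> 0 \<and> (\<forall>i. coeff p i \<in> K) \<and> poly p a = 0}"

definition algebraic_over :: "'a :: field set \<Rightarrow> 'a \<Rightarrow> bool" where
  "algebraic_over K a \<longleftrightarrow> annihilating_polys K a \<noteq> {}"

text \<open>No normalisation is imposed: minimal polynomials are unique up to a nonzero factor in \<open>K\<close>.\<close>

definition is_minimal_poly :: "'a :: field set \<Rightarrow> 'a \<Rightarrow> 'a poly \<Rightarrow> bool" where
  "is_minimal_poly K a p \<longleftrightarrow>
     p \<in> annihilating_polys K a \<and> (\<forall>q \<in> annihilating_polys K a. degree p \<le> degree q)"

end

theory Submission
  imports Defs "HOL-Library.Sublist"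
begin

text \<open>
  Build sequences by value: every sequence arises from a shorter or lower one by adding 1 to all
  entries and inserting at most two zeros. Avoiding 102 permits a non-initial zero exactly at a
  \<^emph>\<open>cut\<close>, a position with no entry behind it larger than an entry before it; initial zeros relax
  the bound \<open>e\<^sub>j < j - 1 + k\<close> instead, so one lets \<open>k\<close> vary. Recording the number of cuts by a
  catalytic variable gives a linear system in \<open>k\<close>. Substituting \<open>1 + d\<close> for that variable, where
  \<open>d = x y (1 + d)\<^sup>2 (d + x (1 + d + d\<^sup>2))\<close>, makes the system telescope in \<open>k\<close>, and letting
  \<open>k\<close> grow gives \<open>x (1 + d - d z) E = d + x (1 + d + d\<^sup>2)\<close>. Eliminating \<open>d\<close> yields the quartic.

  For minimality, \<open>y\<close> and \<open>E\<close> are rational functions of \<open>d\<close> over \<open>\<rat>(x, z)\<close>. At \<open>d = \<infinity>\<close>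
  the function \<open>y\<close> has a triple zero and \<open>E\<close> a simple pole, which in a relation of degree at most 3
  forces the constant coefficient to have strictly the smallest order in \<open>y\<close>; this is impossible
  at \<open>d = 0\<close>, where \<open>y\<close> has a simple zero and \<open>E\<close> is finite.
\<close>

section \<open>Shifted inversion sequences\<close>

text \<open>The obstacle is that the system never closes. A sequence of level \<open>k + 1\<close>
  with two leading zeros comes from one of level \<open>k + 2\<close>, and placing two zeros brings
  in the derivative of the catalytic generating function at 1 beside its value there. The equation
  for \<open>d\<close> is forced by two demands that turn out to be the same one. Write
  \<open>u = 1 + d\<close>. The geometric sums coming from the insertions must collapse to
  \<open>u * u ^ \<tau> - 1\<close> apart from a term linear in \<open>\<tau>\<close>, and the
  values at 1 on level \<open>k + 1\<close> must cancel between consecutive levels. A combination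
  \<open>V k\<close> survives with \<open>d * V (Suc k) = u * V k\<close> up to an explicit term in
  \<open>z ^ k\<close>. As \<open>d\<close> is divisible by x and \<open>u\<close> is a unit, the
  solution is pinned down by divisibility by every power of x. At level 0 all series vanish, so
  \<open>V 0\<close> contains just the wanted series of level 1. The rank is the second difficulty:
  an insertion at a cut preserves it except between two equal maxima at the front. The correction is
  governed by an auxiliary class, \<open>peaked\<close>, whose recurrence uses only the level
  below.\<close>

lemma subseq_Cons_iff_nth:
  "subseq (a # xs) e \<longleftrightarrow> (\<exists>i<length e. e ! i = a \<and> subseq xs (drop (Suc i) e))"
proof (induction e)
  case (Cons b e)
  show ?case
  proof (cases "a = b")
    case True
    have "subseq xs (drop (Suc i) e) \<Longrightarrow> subseq xs e" for i
      by (meson subseq_order.order_trans suffix_drop suffix_imp_subseq)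
    then show ?thesis using True by (auto simp: less_Suc_eq_0_disj)
  next
    case False
    then show ?thesis using Cons by (auto simp: less_Suc_eq_0_disj)
  qed
qed simp

text \<open>Indices shift under insertion of an entry, whereas subsequences split along
  \<open>@\<close>; the patterns are therefore moved from index triples to
  \<open>subseq\<close>.\<close>

lemma subseq3_iff_nth:
  "subseq [a, b, c] e \<longleftrightarrow>
     (\<exists>i j k. i < j \<and> j < k \<and> k < length e \<and> e ! i = a \<and> e ! j = b \<and> e ! k = c)"
proof
  assume "subseq [a, b, c] e"
  then obtain i j k where "i < length e" "e ! i = a" "j < length (drop (Suc i) e)"
    "drop (Suc i) e ! j = b" "k < length (drop (Suc j) (drop (Suc i) e))"
    "drop (Suc j) (drop (Suc i) e) ! k = c"
    unfolding subseq_Cons_iff_nth by blast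
  then show "\<exists>i j k. i < j \<and> j < k \<and> k < length e \<and> e ! i = a \<and> e ! j = b \<and> e ! k = c"
    by (intro exI[of _ i] exI[of _ "Suc i + j"] exI[of _ "Suc i + (Suc j + k)"])
      (auto simp: add_ac)
next
  assume "\<exists>i j k. i < j \<and> j < k \<and> k < length e \<and> e ! i = a \<and> e ! j = b \<and> e ! k = c"
  then obtain i j k where "i < j" "j < k" "k < length e" "e ! i = a" "e ! j = b" "e ! k = c"
    by blast
  then show "subseq [a, b, c] e"
    unfolding subseq_Cons_iff_nth
    by (intro exI[of _ i] exI[of _ "j - Suc i"] exI[of _ "k - Suc j"] conjI) auto
qed

lemma avoids_102_iff_subseq:
  "avoids_102 e \<longleftrightarrow> (\<forall>a b c. subseq [a, b, c] e \<longrightarrow> b < a \<longrightarrow> \<not> a < c)"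
  unfolding avoids_102_def subseq3_iff_nth by metis

lemma subseq_replicate_iff: "subseq (replicate n v) e \<longleftrightarrow> n \<le> count_list e v"
proof (induction e arbitrary: n)
  case Nil
  show ?case by (cases n) auto
next
  case (Cons b e)
  show ?case
  proof (cases n)
    case (Suc m)
    then show ?thesis using Cons[of m] Cons[of n] by (cases "b = v") auto
  qed simp
qed

lemma avoids_000_iff_count: "avoids_000 e \<longleftrightarrow> (\<forall>v. count_list e v \<le> 2)"
proof -
  have "subseq [v, v, v] e \<longleftrightarrow> \<not> count_list e v \<le> 2" for v
    using subseq_replicate_iff[of 3 v e] by (simp add: numeral_3_eq_3 not_le less_eq_Suc_le)
  then show ?thesis unfolding avoids_000_def subseq3_iff_nth by metis
qed

text \<open>\<open>k = 1\<close> gives inversion sequences. Larger \<open>k\<close> is needed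
  because what remains after removing leading zeros obeys a weaker bound.\<close>

fun bounded_from :: "nat \<Rightarrow> nat list \<Rightarrow> bool" where
  "bounded_from k [] = True"
| "bounded_from k (a # e) = (a < k \<and> bounded_from (Suc k) e)"

lemma bounded_from_iff: "bounded_from k e \<longleftrightarrow> (\<forall>i<length e. e ! i < k + i)"
proof (induction e arbitrary: k)
  case (Cons a e)
  then show ?case by (auto simp: nth_Cons split: nat.splits)
qed simp

lemma bounded_from_append:
  "bounded_from k (p @ s) \<longleftrightarrow> bounded_from k p \<and> bounded_from (k + length p) s"
  by (induction p arbitrary: k) auto

lemma bounded_from_map_Suc [simp]: "bounded_from (Suc k) (map Suc f) \<longleftrightarrow> bounded_from k f"
  by (induction f arbitrary: k) auto

lemma bounded_from_bound: "(\<And>a. a \<in> set s \<Longrightarrow> a < k) \<Longrightarrow> bounded_from k s"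
proof -
  have "(\<And>a. a \<in> set s \<Longrightarrow> a < k) \<Longrightarrow> k \<le> k' \<Longrightarrow> bounded_from k' s" for k'
    by (induction s arbitrary: k') (fastforce simp: le_SucI)+
  then show "(\<And>a. a \<in> set s \<Longrightarrow> a < k) \<Longrightarrow> bounded_from k s" by blast
qed

text \<open>The path height \<open>k + p - 1 - e\<^sub>p\<close> at the first descent \<open>p\<close>; adding 1 to all entries
  and to \<open>k\<close> leaves it unchanged.\<close>

fun shifted_rank :: "nat \<Rightarrow> nat list \<Rightarrow> nat" where
  "shifted_rank k [] = k - 1"
| "shifted_rank k [a] = k - 1 - a"
| "shifted_rank k (a # b # e) = (if b < a then k - 1 - a else shifted_rank (Suc k) (b # e))"

lemma first_descent_Cons:
  "first_descent (a # b # e) = (if b < a then 0 else Suc (first_descent (b # e)))"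
proof (cases "b < a")
  case True
  then show ?thesis unfolding first_descent_def by (auto intro!: Least_equality)
next
  case False
  have ex: "\<exists>i. i < length (b # e) \<and> (Suc i < length (b # e) \<longrightarrow> (b # e) ! Suc i < (b # e) ! i)"
    by (rule exI[of _ "length e"]) simp
  show ?thesis using False unfolding first_descent_def
    by (subst Least_Suc[where n = "Suc (length e)"]) auto
qed

lemma shifted_rank_eq:
  "e \<noteq> [] \<Longrightarrow> shifted_rank k e = k + first_descent e - 1 - e ! first_descent e"
proof (induction k e rule: shifted_rank.induct)
  case (2 k a)
  have "first_descent [a] = 0" unfolding first_descent_def by (auto intro!: Least_equality)
  then show ?case by simp
qed (auto simp: first_descent_Cons)

lemma rank_eq_shifted_rank: "rank e = shifted_rank 1 e"
  by (cases "e = []") (auto simp: rank_def shifted_rank_eq)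

definition avoiders :: "nat \<Rightarrow> nat list set" where
  "avoiders k = {e. bounded_from k e \<and> avoids_102 e \<and> (\<forall>v. count_list e v \<le> 2)}"

lemma IS_102_000_eq:
  "IS_102_000 n m t = {e \<in> avoiders 1. length e = n \<and> card (set e) = m \<and> shifted_rank 1 e = t}"
  unfolding IS_102_000_def avoiders_def inversion_seq_def dist_entries_def
  by (auto simp: bounded_from_iff avoids_000_iff_count rank_eq_shifted_rank less_Suc_eq_le)

lemma finite_avoiders_length: "finite {e \<in> avoiders k. length e = n}"
proof (rule finite_subset)
  show "{e \<in> avoiders k. length e = n} \<subseteq> {e. set e \<subseteq> {..<k + n} \<and> length e = n}"
    by (force simp: avoiders_def bounded_from_iff in_set_conv_nth)
  show "finite {e. set e \<subseteq> {..<k + n} \<and> length e = n}"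
    by (rule finite_lists_length_eq) simp
qed

text \<open>An occurrence in the longer list avoids the new entry or uses it as its first, middle or
  last member.\<close>

lemma subseq3_insert:
  "subseq [a, b, c] (p @ z # s) \<longleftrightarrow> subseq [a, b, c] (p @ s) \<or> (a = z \<and> subseq [b, c] s) \<or>
     (b = z \<and> a \<in> set p \<and> c \<in> set s) \<or> (c = z \<and> subseq [a, b] p)"
proof -
  have 3: "subseq [a, b, c] (p @ s) \<longleftrightarrow> subseq [a, b, c] s \<or> (a \<in> set p \<and> subseq [b, c] s) \<or>
     (subseq [a, b] p \<and> c \<in> set s) \<or> subseq [a, b, c] p" for p s :: "'a list"
  proof
    assume "subseq [a, b, c] (p @ s)"
    then obtain u v where "[a, b, c] = u @ v" "subseq u p" "subseq v s"
      by (auto simp: subseq_append_iff)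
    then show "subseq [a, b, c] s \<or> (a \<in> set p \<and> subseq [b, c] s) \<or>
     (subseq [a, b] p \<and> c \<in> set s) \<or> subseq [a, b, c] p"
      by (auto simp: Cons_eq_append_conv subseq_singleton_left)
  next
    have "a \<in> set p \<and> subseq [b, c] s \<Longrightarrow> subseq ([a] @ [b, c]) (p @ s)"
      by (rule list_emb_append_mono) (auto simp: subseq_singleton_left)
    moreover have "subseq [a, b] p \<and> c \<in> set s \<Longrightarrow> subseq ([a, b] @ [c]) (p @ s)"
      by (rule list_emb_append_mono) (auto simp: subseq_singleton_left)
    moreover have "subseq [a, b, c] p \<Longrightarrow> subseq ([a, b, c] @ []) (p @ s)"
      by (rule list_emb_append_mono) auto
    moreover have "subseq [a, b, c] s \<Longrightarrow> subseq ([] @ [a, b, c]) (p @ s)"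
      by (rule list_emb_append_mono) auto
    moreover assume "subseq [a, b, c] s \<or> (a \<in> set p \<and> subseq [b, c] s) \<or>
     (subseq [a, b] p \<and> c \<in> set s) \<or> subseq [a, b, c] p"
    ultimately show "subseq [a, b, c] (p @ s)" by auto
  qed
  have tl3: "subseq [a, b, c] s \<Longrightarrow> subseq [b, c] s" and tl2: "subseq [b, c] s \<Longrightarrow> c \<in> set s"
    by (metis subseq_Cons')(metis subseq_Cons' subseq_singleton_left)
  show ?thesis unfolding 3[of p s] 3[of p "z # s"] using tl2 tl3
    by (auto simp: subseq_singleton_left)
qed

section \<open>Inserting zeros\<close>

text \<open>Position 0 is left out because a leading zero is always permitted but changes the bound;
  the end of a nonempty list always counts. Equality \<open>b = a\<close> is harmless, since 102
  asks for strict inequalities.\<close>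

definition cuts :: "nat list \<Rightarrow> nat set" where
  "cuts f = {q. 0 < q \<and> q \<le> length f \<and> (\<forall>a\<in>set (take q f). \<forall>b\<in>set (drop q f). b \<le> a)}"

definition insert_zero :: "nat \<Rightarrow> nat list \<Rightarrow> nat list" where
  "insert_zero q f = map Suc (take q f) @ 0 # map Suc (drop q f)"

text \<open>Both positions refer to \<open>f\<close>, so \<open>q = r\<close> produces two adjacent
  zeros.\<close>

definition insert_zeros :: "nat \<Rightarrow> nat \<Rightarrow> nat list \<Rightarrow> nat list" where
  "insert_zeros q r f =
     map Suc (take q f) @ 0 # map Suc (drop q (take r f)) @ 0 # map Suc (drop r f)"

lemma finite_cuts [simp]: "finite (cuts f)"
  by (rule finite_subset[of _ "{..length f}"]) (auto simp: cuts_def)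

lemma cuts_le_length: "q \<in> cuts f \<Longrightarrow> q \<le> length f"
  by (simp add: cuts_def)

lemma count_list_map_Suc [simp]:
  "count_list (map Suc f) 0 = 0" "count_list (map Suc f) (Suc v) = count_list f v"
  by (induction f) auto

lemma avoids_102_map_Suc [simp]: "avoids_102 (map Suc f) \<longleftrightarrow> avoids_102 f"
proof -
  have "(i < j \<and> j < k \<and> k < length f \<and> map Suc f ! j < map Suc f ! i \<and> map Suc f ! i < map Suc f ! k)
    \<longleftrightarrow> (i < j \<and> j < k \<and> k < length f \<and> f ! j < f ! i \<and> f ! i < f ! k)" for i j k
    by (cases "i < j \<and> j < k \<and> k < length f") auto
  then show ?thesis unfolding avoids_102_def length_map by presburger
qed

lemma map_Suc_in_avoiders [simp]: "map Suc f \<in> avoiders (Suc k) \<longleftrightarrow> f \<in> avoiders k"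
proof -
  have "(\<forall>v. count_list (map Suc f) v \<le> 2) \<longleftrightarrow> (\<forall>v. count_list f v \<le> 2)"
    by (metis count_list_map_Suc le0 not0_implies_Suc)
  then show ?thesis by (simp add: avoiders_def)
qed

text \<open>A zero can only be the smallest, hence the middle, member of a 102 pattern.\<close>

lemma avoids_102_insert_0:
  "avoids_102 (p @ 0 # s) \<longleftrightarrow>
     avoids_102 (p @ s) \<and> (\<forall>a\<in>set p. \<forall>c\<in>set s. 0 < a \<longrightarrow> c \<le> a)"
  unfolding avoids_102_iff_subseq subseq3_insert by (auto simp: not_less)

text \<open>The head of \<open>p\<close> is below \<open>k\<close> and dominates \<open>s\<close>,
  so the positions of the entries of \<open>s\<close> are irrelevant. Hence a zero inserted at a cut
  never affects the bound.\<close>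

lemma bounded_from_append_below:
  assumes "bounded_from k p" "p \<noteq> []" "\<forall>a\<in>set p. \<forall>c\<in>set s. c \<le> a" "k \<le> k'"
  shows "bounded_from k' s"
proof (rule bounded_from_bound)
  fix c assume "c \<in> set s"
  then show "c < k'" using assms by (cases p) (force, force)
qed

text \<open>Lowering the entries by 1 costs one unit of \<open>k\<close>. A leading zero gives it
  back, because everything behind it moves one place forward when it is removed.\<close>

lemma one_zero_in_avoiders:
  "map Suc p @ 0 # map Suc s \<in> avoiders (Suc k) \<longleftrightarrow>
     (\<forall>a\<in>set p. \<forall>c\<in>set s. c \<le> a) \<and> p @ s \<in> avoiders (if p = [] then Suc k else k)"
    (is "?e \<in> _ \<longleftrightarrow> ?cut \<and> _")
proof -
  have "(\<forall>v. count_list ?e v \<le> 2) \<longleftrightarrow> (\<forall>v. count_list (p @ s) v \<le> 2)"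
  proof -
    have "count_list ?e 0 = 1" "count_list ?e (Suc v) = count_list (p @ s) v" for v by simp_all
    then show ?thesis by (metis not0_implies_Suc one_le_numeral)
  qed
  moreover have "avoids_102 ?e \<longleftrightarrow> avoids_102 (p @ s) \<and> ?cut"
    unfolding avoids_102_insert_0 by (simp flip: map_append)
  moreover have "bounded_from (Suc k) ?e \<longleftrightarrow> bounded_from (if p = [] then Suc k else k) (p @ s)" if ?cut
    using that bounded_from_append_below[of k p s "k + length p"]
      bounded_from_append_below[of k p s "Suc (k + length p)"]
    by (auto simp: bounded_from_append)
  ultimately show ?thesis unfolding avoiders_def by auto
qed

text \<open>Each leading zero gives back one unit of \<open>k\<close>, so two of them lead to a
  level above the original one. The recurrence therefore looks upwards as well as downwards.\<close>

lemma two_zeros_in_avoiders: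
  "map Suc p @ 0 # map Suc m @ 0 # map Suc s \<in> avoiders (Suc k) \<longleftrightarrow>
     (\<forall>a\<in>set p. \<forall>c\<in>set (m @ s). c \<le> a) \<and> (\<forall>a\<in>set (p @ m). \<forall>c\<in>set s. c \<le> a) \<and>
     p @ m @ s \<in> avoiders (if p = [] then if m = [] then Suc (Suc k) else Suc k else k)"
    (is "?e \<in> _ \<longleftrightarrow> ?cut1 \<and> ?cut2 \<and> _ \<in> avoiders ?k")
proof -
  have "(\<forall>v. count_list ?e v \<le> 2) \<longleftrightarrow> (\<forall>v. count_list (p @ m @ s) v \<le> 2)"
  proof -
    have "count_list ?e 0 = 2" "count_list ?e (Suc v) = count_list (p @ m @ s) v" for v by simp_all
    then show ?thesis by (metis not0_implies_Suc order_refl)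
  qed
  moreover have "avoids_102 ?e \<longleftrightarrow> avoids_102 (p @ m @ s) \<and> ?cut1 \<and> ?cut2"
  proof -
    have "avoids_102 ?e \<longleftrightarrow> avoids_102 ((map Suc p @ map Suc m) @ 0 # map Suc s) \<and> ?cut1"
      unfolding avoids_102_insert_0[of "map Suc p"] by auto
    also have "avoids_102 ((map Suc p @ map Suc m) @ 0 # map Suc s) \<longleftrightarrow>
        avoids_102 (p @ m @ s) \<and> ?cut2"
      unfolding avoids_102_insert_0[of "map Suc p @ map Suc m"]
      by (auto simp flip: map_append)
    finally show ?thesis by blast
  qed
  moreover have "bounded_from (Suc k) ?e \<longleftrightarrow> bounded_from ?k (p @ m @ s)" if ?cut1 ?cut2
  proof (cases "p = []")
    case False
    then show ?thesis
      using that bounded_from_append_below[of k p m] bounded_from_append_below[of k p s]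
      by (auto simp: bounded_from_append)
  next
    case True
    then show ?thesis
      using that bounded_from_append_below[of "Suc k" m s]
      by (auto simp: bounded_from_append)
  qed
  ultimately show ?thesis unfolding avoiders_def by auto
qed

lemma map_Suc_append_0_eq_iff [simp]:
  "map Suc p @ 0 # s = map Suc p' @ 0 # s' \<longleftrightarrow> p = p' \<and> s = s'"
proof (induction p arbitrary: p')
  case Nil
  then show ?case by (cases p') auto
next
  case (Cons a p)
  then show ?case by (cases p') auto
qed

lemma no_zero_map_Suc: "count_list e 0 = 0 \<Longrightarrow> \<exists>f. e = map Suc f"
proof (induction e)
  case (Cons a e)
  then obtain f where "e = map Suc f" "a \<noteq> 0" by (auto split: if_splits)
  then have "a # e = map Suc ((a - 1) # f)" by simp
  then show ?case by (rule exI)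
qed simp

lemma split_first_zero:
  assumes "0 \<in> set e"
  obtains p s where "e = map Suc p @ 0 # s" "count_list e 0 = Suc (count_list s 0)"
proof -
  obtain p' s where e: "e = p' @ 0 # s" "0 \<notin> set p'"
    using split_list_first[OF assms] by blast
  then obtain p where "p' = map Suc p" using no_zero_map_Suc[of p'] by (auto simp: count_list_0_iff)
  with e show ?thesis using that[of p s] by simp
qed

lemma one_zero_cases:
  assumes "count_list e 0 = 1"
  obtains p s where "e = map Suc p @ 0 # map Suc s"
proof -
  have "0 \<in> set e" using assms by (metis count_notin zero_neq_one)
  then obtain p s where "e = map Suc p @ 0 # s" "count_list e 0 = Suc (count_list s 0)"
    by (rule split_first_zero)
  then show ?thesis using that no_zero_map_Suc[of s] assms by auto
qed

lemma two_zeros_cases: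
  assumes "count_list e 0 = 2"
  obtains p m s where "e = map Suc p @ 0 # map Suc m @ 0 # map Suc s"
proof -
  have "0 \<in> set e" using assms by (metis count_notin zero_neq_numeral)
  then obtain p s where *: "e = map Suc p @ 0 # s" "count_list e 0 = Suc (count_list s 0)"
    by (rule split_first_zero)
  then have "count_list s 0 = 1" using assms by simp
  then obtain m t where "s = map Suc m @ 0 # map Suc t" by (rule one_zero_cases)
  then show ?thesis using that * by blast
qed

lemma inj_insert_zero: "insert_zero q f = insert_zero q' f' \<Longrightarrow> q \<le> length f \<Longrightarrow> q' \<le> length f' \<Longrightarrow> q = q' \<and> f = f'"
  unfolding insert_zero_def map_Suc_append_0_eq_iff inj_map_eq_map[OF inj_Suc]
  by (metis append_take_drop_id length_take min.absorb2)

lemma inj_insert_zeros: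
  assumes "insert_zeros q r f = insert_zeros q' r' f'"
    "q \<le> r" "r \<le> length f" "q' \<le> r'" "r' \<le> length f'"
  shows "q = q' \<and> r = r' \<and> f = f'"
proof -
  have *: "take q f = take q' f'" "drop q (take r f) = drop q' (take r' f')" "drop r f = drop r' f'"
    using assms(1) by (simp_all add: insert_zeros_def inj_map_eq_map[OF inj_Suc])
  then have "q = q'" "r - q = r' - q'"
    using assms(2-) by (metis length_take min.absorb2 order_trans, metis length_drop length_take min.absorb2)
  then have "q = q'" "r = r'" using assms by auto
  moreover have "take r f = take r' f'"
    using * calculation assms by (metis append_take_drop_id min.absorb1 take_take)
  ultimately show ?thesis using * by (metis append_take_drop_id)
qed

lemma take_drop_between:
  "q \<le> r \<Longrightarrow> drop q (take r f) @ drop r f = drop q f"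
  using drop_append[of q "take r f" "drop r f"] by (cases "r \<le> length f") auto

lemma take_append_between:
  "q \<le> r \<Longrightarrow> take q f @ drop q (take r f) = take r f"
  by (metis append_take_drop_id min.absorb1 take_take)

lemma length_insert_zero [simp]: "length (insert_zero q f) = Suc (length f)"
  by (simp add: insert_zero_def min_def)

lemma length_insert_zeros [simp]: "q \<le> r \<Longrightarrow> length (insert_zeros q r f) = Suc (Suc (length f))"
  by (auto simp: insert_zeros_def min_def)

lemma hd_insert_zero: "q \<in> cuts f \<Longrightarrow> 0 < hd (insert_zero q f)"
  by (cases f; cases q) (auto simp: cuts_def insert_zero_def)

lemma hd_insert_zeros: "q \<in> cuts f \<Longrightarrow> 0 < hd (insert_zeros q r f)"
  by (cases f; cases q) (auto simp: cuts_def insert_zeros_def)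

lemma count_list_insert_zero [simp]: "count_list (insert_zero q f) 0 = 1"
  by (simp add: insert_zero_def)

lemma count_list_insert_zeros [simp]: "count_list (insert_zeros q r f) 0 = 2"
  by (simp add: insert_zeros_def)

section \<open>Decomposition by the number of zeros and of leading zeros\<close>

definition avoiders_of_length :: "nat \<Rightarrow> nat \<Rightarrow> nat list set" where
  "avoiders_of_length k n = {e \<in> avoiders k. length e = n}"

lemma bij_no_zero:
  "bij_betw (map Suc) (avoiders_of_length k n)
     {e \<in> avoiders_of_length (Suc k) n. count_list e 0 = 0}"
proof (rule bij_betw_imageI)
  show "inj_on (map Suc) (avoiders_of_length k n)" by (simp add: inj_on_def inj_map_eq_map)
  show "map Suc ` avoiders_of_length k n = {e \<in> avoiders_of_length (Suc k) n. count_list e 0 = 0}"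
  proof
    show "map Suc ` avoiders_of_length k n \<subseteq> {e \<in> avoiders_of_length (Suc k) n. count_list e 0 = 0}"
      by (auto simp: avoiders_of_length_def)
    show "{e \<in> avoiders_of_length (Suc k) n. count_list e 0 = 0} \<subseteq> map Suc ` avoiders_of_length k n"
    proof
      fix e assume e: "e \<in> {e \<in> avoiders_of_length (Suc k) n. count_list e 0 = 0}"
      then obtain f where "e = map Suc f" using no_zero_map_Suc by blast
      then show "e \<in> map Suc ` avoiders_of_length k n"
        using e by (simp add: avoiders_of_length_def)
    qed
  qed
qed

lemma bij_one_zero:
  "bij_betw (\<lambda>(f, q). insert_zero q f) (Sigma (avoiders_of_length k n) cuts)
     {e \<in> avoiders_of_length (Suc k) (Suc n). count_list e 0 = 1 \<and> hd e \<noteq> 0}"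
proof (rule bij_betw_imageI)
  show "inj_on (\<lambda>(f, q). insert_zero q f) (Sigma (avoiders_of_length k n) cuts)"
    by (intro inj_onI) (auto dest!: inj_insert_zero simp: cuts_le_length)
  show "(\<lambda>(f, q). insert_zero q f) ` Sigma (avoiders_of_length k n) cuts =
    {e \<in> avoiders_of_length (Suc k) (Suc n). count_list e 0 = 1 \<and> hd e \<noteq> 0}" (is "?l = ?r")
  proof
    show "?l \<subseteq> ?r"
    proof clarify
      fix f q assume *: "f \<in> avoiders_of_length k n" "q \<in> cuts f"
      then have "map Suc (take q f) @ 0 # map Suc (drop q f) \<in> avoiders (Suc k)"
        by (subst one_zero_in_avoiders) (auto simp: cuts_def avoiders_of_length_def)
      then have "insert_zero q f \<in> avoiders (Suc k)" by (simp add: insert_zero_def)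
      then show "insert_zero q f \<in> avoiders_of_length (Suc k) (Suc n) \<and>
          count_list (insert_zero q f) 0 = 1 \<and> hd (insert_zero q f) \<noteq> 0"
        using * hd_insert_zero[of q f] by (simp add: avoiders_of_length_def)
    qed
    show "?r \<subseteq> ?l"
    proof
      fix e assume e: "e \<in> ?r"
      then obtain p s where ps: "e = map Suc p @ 0 # map Suc s" using one_zero_cases by blast
      with e have "p \<noteq> []" by auto
      with e have *: "\<forall>a\<in>set p. \<forall>c\<in>set s. c \<le> a" "p @ s \<in> avoiders k" "length (p @ s) = n"
        unfolding ps avoiders_of_length_def by (auto simp: one_zero_in_avoiders)
      then have "(p @ s, length p) \<in> Sigma (avoiders_of_length k n) cuts"
        using \<open>p \<noteq> []\<close> by (auto simp: cuts_def avoiders_of_length_def)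
      moreover have "e = insert_zero (length p) (p @ s)" unfolding ps insert_zero_def by simp
      ultimately show "e \<in> ?l" by force
    qed
  qed
qed

lemma bij_one_zero_front:
  "bij_betw (\<lambda>f. 0 # map Suc f) (avoiders_of_length (Suc k) n)
     {e \<in> avoiders_of_length (Suc k) (Suc n). count_list e 0 = 1 \<and> hd e = 0}"
proof (rule bij_betw_imageI)
  show "inj_on (\<lambda>f. 0 # map Suc f) (avoiders_of_length (Suc k) n)"
    by (simp add: inj_on_def inj_map_eq_map)
  have *: "0 # map Suc f \<in> avoiders (Suc k) \<longleftrightarrow> f \<in> avoiders (Suc k)" for f
    using one_zero_in_avoiders[of "[]" f k] by simp
  show "(\<lambda>f. 0 # map Suc f) ` avoiders_of_length (Suc k) n =
    {e \<in> avoiders_of_length (Suc k) (Suc n). count_list e 0 = 1 \<and> hd e = 0}" (is "?l = ?r")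
  proof
    show "?l \<subseteq> ?r" using * by (auto simp: avoiders_of_length_def)
    show "?r \<subseteq> ?l"
    proof
      fix e assume e: "e \<in> ?r"
      then obtain e' where e': "e = 0 # e'" by (cases e) (auto simp: avoiders_of_length_def)
      with e obtain f where "e' = map Suc f" using no_zero_map_Suc[of e'] by auto
      then show "e \<in> ?l" using e e' * by (auto simp: avoiders_of_length_def)
    qed
  qed
qed

lemma bij_two_zeros:
  "bij_betw (\<lambda>(f, q, r). insert_zeros q r f)
     (Sigma (avoiders_of_length k n) (\<lambda>f. Sigma (cuts f) (\<lambda>q. {r \<in> cuts f. q \<le> r})))
     {e \<in> avoiders_of_length (Suc k) (Suc (Suc n)). count_list e 0 = 2 \<and> hd e \<noteq> 0}"
proof (rule bij_betw_imageI)
  let ?D = "Sigma (avoiders_of_length k n) (\<lambda>f. Sigma (cuts f) (\<lambda>q. {r \<in> cuts f. q \<le> r}))"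
  show "inj_on (\<lambda>(f, q, r). insert_zeros q r f) ?D"
  proof (rule inj_onI)
    fix u v assume "u \<in> ?D" "v \<in> ?D"
      "(\<lambda>(f, q, r). insert_zeros q r f) u = (\<lambda>(f, q, r). insert_zeros q r f) v"
    moreover obtain f q r where u: "u = (f, q, r)" by (rule prod_cases3)
    moreover obtain f' q' r' where v: "v = (f', q', r')" by (rule prod_cases3)
    ultimately show "u = v"
      using inj_insert_zeros[of q r f q' r' f'] cuts_le_length[of r f] cuts_le_length[of r' f']
      by simp
  qed
  show "(\<lambda>(f, q, r). insert_zeros q r f) ` ?D =
    {e \<in> avoiders_of_length (Suc k) (Suc (Suc n)). count_list e 0 = 2 \<and> hd e \<noteq> 0}" (is "?l = ?r")
  proof
    show "?l \<subseteq> ?r"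
    proof clarify
      fix f q r assume *: "f \<in> avoiders_of_length k n" "q \<in> cuts f" "r \<in> cuts f" "q \<le> r"
      have eqs: "drop q (take r f) @ drop r f = drop q f" "take q f @ drop q (take r f) = take r f"
        "take q f @ drop q f = f"
        using *(4) by (simp_all only: take_drop_between take_append_between append_take_drop_id)
      have "take q f \<noteq> []" using *(2) by (auto simp: cuts_def)
      then have k: "(if take q f = [] then if drop q (take r f) = [] then Suc (Suc k) else Suc k else k) = k"
        by (rule if_not_P)
      have "\<forall>a\<in>set (take q f). \<forall>c\<in>set (drop q f). c \<le> a"
        "\<forall>a\<in>set (take r f). \<forall>c\<in>set (drop r f). c \<le> a"
        using *(2,3) unfolding cuts_def by blast+
      moreover have "f \<in> avoiders k" using *(1) by (simp add: avoiders_of_length_def)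
      ultimately have "map Suc (take q f) @ 0 # map Suc (drop q (take r f)) @ 0 # map Suc (drop r f)
          \<in> avoiders (Suc k)"
        unfolding two_zeros_in_avoiders eqs k by blast
      then have "insert_zeros q r f \<in> avoiders (Suc k)" by (simp add: insert_zeros_def)
      then show "insert_zeros q r f \<in> avoiders_of_length (Suc k) (Suc (Suc n)) \<and>
          count_list (insert_zeros q r f) 0 = 2 \<and> hd (insert_zeros q r f) \<noteq> 0"
        using * hd_insert_zeros[of q f r] by (simp add: avoiders_of_length_def)
    qed
    show "?r \<subseteq> ?l"
    proof
      fix e assume e: "e \<in> ?r"
      then obtain p m s where pms: "e = map Suc p @ 0 # map Suc m @ 0 # map Suc s"
        using two_zeros_cases by blast
      with e have "p \<noteq> []" by auto
      with e have *: "\<forall>a\<in>set p. \<forall>c\<in>set (m @ s). c \<le> a" "\<forall>a\<in>set (p @ m). \<forall>c\<in>set s. c \<le> a"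
        "p @ m @ s \<in> avoiders k" "length (p @ m @ s) = n"
        unfolding pms avoiders_of_length_def by (auto simp: two_zeros_in_avoiders)
      then have "(p @ m @ s, length p, length (p @ m)) \<in> ?D"
        using \<open>p \<noteq> []\<close> by (auto simp: cuts_def avoiders_of_length_def)
      moreover have "e = insert_zeros (length p) (length (p @ m)) (p @ m @ s)"
        unfolding pms insert_zeros_def by simp
      ultimately show "e \<in> ?l" by force
    qed
  qed
qed

lemma bij_two_zeros_front:
  "bij_betw (\<lambda>(f, r). 0 # insert_zero r f) (Sigma (avoiders_of_length (Suc k) n) cuts)
     {e \<in> avoiders_of_length (Suc k) (Suc (Suc n)).
        count_list e 0 = 2 \<and> hd e = 0 \<and> hd (tl e) \<noteq> 0}"
proof (rule bij_betw_imageI)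
  let ?D = "Sigma (avoiders_of_length (Suc k) n) cuts"
  show "inj_on (\<lambda>(f, r). 0 # insert_zero r f) ?D"
    by (intro inj_onI) (auto dest!: inj_insert_zero simp: cuts_le_length)
  show "(\<lambda>(f, r). 0 # insert_zero r f) ` ?D =
    {e \<in> avoiders_of_length (Suc k) (Suc (Suc n)).
        count_list e 0 = 2 \<and> hd e = 0 \<and> hd (tl e) \<noteq> 0}" (is "?l = ?r")
  proof
    show "?l \<subseteq> ?r"
    proof clarify
      fix f r assume *: "f \<in> avoiders_of_length (Suc k) n" "r \<in> cuts f"
      have "take r f \<noteq> []" using *(2) by (auto simp: cuts_def)
      then have k: "(if [] = [] then if take r f = [] then Suc (Suc k) else Suc k else k) = Suc k"
        by simp
      have "\<forall>a\<in>set (take r f). \<forall>c\<in>set (drop r f). c \<le> a"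
        using *(2) unfolding cuts_def by blast
      moreover have "f \<in> avoiders (Suc k)" using *(1) by (simp add: avoiders_of_length_def)
      ultimately have "map Suc [] @ 0 # map Suc (take r f) @ 0 # map Suc (drop r f) \<in> avoiders (Suc k)"
        unfolding two_zeros_in_avoiders k append_Nil append_take_drop_id list.set(1) by blast
      then have "0 # insert_zero r f \<in> avoiders (Suc k)" by (simp add: insert_zero_def)
      then show "0 # insert_zero r f \<in> avoiders_of_length (Suc k) (Suc (Suc n)) \<and>
          count_list (0 # insert_zero r f) 0 = 2 \<and> hd (0 # insert_zero r f) = 0 \<and>
          hd (tl (0 # insert_zero r f)) \<noteq> 0"
        using * hd_insert_zero[of r f] by (simp add: avoiders_of_length_def)
    qed
    show "?r \<subseteq> ?l"
    proof
      fix e assume e: "e \<in> ?r"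
      then obtain p m s where pms: "e = map Suc p @ 0 # map Suc m @ 0 # map Suc s"
        using two_zeros_cases by blast
      with e have "p = []" "m \<noteq> []" by (cases p; auto)+
      with e have *: "\<forall>a\<in>set m. \<forall>c\<in>set s. c \<le> a" "m @ s \<in> avoiders (Suc k)" "length (m @ s) = n"
        unfolding pms avoiders_of_length_def using two_zeros_in_avoiders[of p m s k] by auto
      then have "(m @ s, length m) \<in> ?D"
        using \<open>m \<noteq> []\<close> by (auto simp: cuts_def avoiders_of_length_def)
      moreover have "e = 0 # insert_zero (length m) (m @ s)"
        unfolding pms insert_zero_def \<open>p = []\<close> by simp
      ultimately show "e \<in> ?l" by force
    qed
  qed
qed

lemma bij_two_zeros_front_front:
  "bij_betw (\<lambda>f. 0 # 0 # map Suc f) (avoiders_of_length (Suc (Suc k)) n)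
     {e \<in> avoiders_of_length (Suc k) (Suc (Suc n)).
        count_list e 0 = 2 \<and> hd e = 0 \<and> hd (tl e) = 0}"
proof (rule bij_betw_imageI)
  show "inj_on (\<lambda>f. 0 # 0 # map Suc f) (avoiders_of_length (Suc (Suc k)) n)"
    by (simp add: inj_on_def inj_map_eq_map)
  have *: "0 # 0 # map Suc f \<in> avoiders (Suc k) \<longleftrightarrow> f \<in> avoiders (Suc (Suc k))" for f
    using two_zeros_in_avoiders[of "[]" "[]" f k] by simp
  show "(\<lambda>f. 0 # 0 # map Suc f) ` avoiders_of_length (Suc (Suc k)) n =
    {e \<in> avoiders_of_length (Suc k) (Suc (Suc n)).
        count_list e 0 = 2 \<and> hd e = 0 \<and> hd (tl e) = 0}" (is "?l = ?r")
  proof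
    show "?l \<subseteq> ?r" using * by (auto simp: avoiders_of_length_def)
    show "?r \<subseteq> ?l"
    proof
      fix e assume e: "e \<in> ?r"
      then obtain e' where e': "e = 0 # 0 # e'"
        by (cases e; cases "tl e") (auto simp: avoiders_of_length_def)
      with e obtain f where "e' = map Suc f" using no_zero_map_Suc[of e'] by auto
      then show "e \<in> ?l" using e e' * by (auto simp: avoiders_of_length_def)
    qed
  qed
qed

lemma finite_avoiders_of_length [simp]: "finite (avoiders_of_length k n)"
  unfolding avoiders_of_length_def by (rule finite_avoiders_length)

text \<open>The six sums are the six classes: no zero; one zero, at a cut or in front; two zeros, of
  which none, one or both are leading. \<open>\<Omega>\<close> stays arbitrary because the
  decomposition is used both for nonempty and for \<open>peaked\<close> sequences.\<close>

lemma sum_avoiders_Suc: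
  fixes \<Omega> :: "nat list \<Rightarrow> 'a::comm_monoid_add"
  shows "(\<Sum>e\<in>avoiders_of_length (Suc k) n. \<Omega> e) =
    (\<Sum>f\<in>avoiders_of_length k n. \<Omega> (map Suc f)) +
    (if 1 \<le> n then
       (\<Sum>f\<in>avoiders_of_length k (n - 1). \<Sum>q\<in>cuts f. \<Omega> (insert_zero q f)) +
       (\<Sum>f\<in>avoiders_of_length (Suc k) (n - 1). \<Omega> (0 # map Suc f)) else 0) +
    (if 2 \<le> n then
       (\<Sum>f\<in>avoiders_of_length k (n - 2). \<Sum>q\<in>cuts f. \<Sum>r\<in>{r \<in> cuts f. q \<le> r}. \<Omega> (insert_zeros q r f)) +
       (\<Sum>f\<in>avoiders_of_length (Suc k) (n - 2). \<Sum>r\<in>cuts f. \<Omega> (0 # insert_zero r f)) +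
       (\<Sum>f\<in>avoiders_of_length (Suc (Suc k)) (n - 2). \<Omega> (0 # 0 # map Suc f)) else 0)"
proof -
  let ?T = "avoiders_of_length (Suc k) n"
  have split: "sum \<Omega> T = sum \<Omega> {e \<in> T. P e} + sum \<Omega> {e \<in> T. \<not> P e}" if "finite T" for P T
    using that by (subst sum.union_disjoint[symmetric]) (auto intro: sum.cong)
  have le2: "count_list e 0 \<le> 2" if "e \<in> ?T" for e
    using that by (auto simp: avoiders_of_length_def avoiders_def)
  define T1 where "T1 = {e \<in> ?T. count_list e 0 = 1}"
  define T2 where "T2 = {e \<in> ?T. count_list e 0 = 2}"
  have fin: "finite T1" "finite T2" by (simp_all add: T1_def T2_def)
  have "sum \<Omega> ?T = sum \<Omega> {e \<in> ?T. count_list e 0 = 0} + sum \<Omega> {e \<in> ?T. count_list e 0 \<noteq> 0}"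
    by (rule split) simp
  also have "sum \<Omega> {e \<in> ?T. count_list e 0 = 0} = (\<Sum>f\<in>avoiders_of_length k n. \<Omega> (map Suc f))"
    using sum.reindex_bij_betw[OF bij_no_zero] by (rule sym)
  also have "{e \<in> ?T. count_list e 0 \<noteq> 0} = T1 \<union> T2"
    using le2 by (force simp: T1_def T2_def le_Suc_eq numeral_2_eq_2)
  also have "sum \<Omega> (T1 \<union> T2) = sum \<Omega> T1 + sum \<Omega> T2"
    by (rule sum.union_disjoint) (auto simp: T1_def T2_def)
  also have "sum \<Omega> T1 = (if 1 \<le> n then
       (\<Sum>f\<in>avoiders_of_length k (n - 1). \<Sum>q\<in>cuts f. \<Omega> (insert_zero q f)) +
       (\<Sum>f\<in>avoiders_of_length (Suc k) (n - 1). \<Omega> (0 # map Suc f)) else 0)"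
  proof (cases n)
    case 0
    then have "T1 = {}" by (auto simp: T1_def avoiders_of_length_def)
    then show ?thesis using 0 by simp
  next
    case (Suc n')
    have "sum \<Omega> T1 = sum \<Omega> {e \<in> ?T. count_list e 0 = 1 \<and> hd e \<noteq> 0} +
        sum \<Omega> {e \<in> ?T. count_list e 0 = 1 \<and> hd e = 0}"
      using split[OF fin(1), of "\<lambda>e. hd e \<noteq> 0"] by (simp add: T1_def conj_assoc)
    then show ?thesis
      unfolding Suc using sum.reindex_bij_betw[OF bij_one_zero, of \<Omega> k n']
        sum.reindex_bij_betw[OF bij_one_zero_front, of \<Omega> k n']
      by (simp add: sum.Sigma case_prod_unfold)
  qed
  also have "sum \<Omega> T2 = (if 2 \<le> n then
       (\<Sum>f\<in>avoiders_of_length k (n - 2). \<Sum>q\<in>cuts f. \<Sum>r\<in>{r \<in> cuts f. q \<le> r}. \<Omega> (insert_zeros q r f)) +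
       (\<Sum>f\<in>avoiders_of_length (Suc k) (n - 2). \<Sum>r\<in>cuts f. \<Omega> (0 # insert_zero r f)) +
       (\<Sum>f\<in>avoiders_of_length (Suc (Suc k)) (n - 2). \<Omega> (0 # 0 # map Suc f)) else 0)"
  proof (cases "2 \<le> n")
    case False
    have "\<not> e \<in> T2" for e
      using False count_le_length[of e 0] by (auto simp: T2_def avoiders_of_length_def)
    then have "T2 = {}" by blast
    then show ?thesis using False by simp
  next
    case True
    then obtain n' where n': "n = Suc (Suc n')" by (metis add_2_eq_Suc le_Suc_ex)
    have "sum \<Omega> T2 = sum \<Omega> {e \<in> ?T. count_list e 0 = 2 \<and> hd e \<noteq> 0} +
        sum \<Omega> {e \<in> ?T. count_list e 0 = 2 \<and> hd e = 0}"
      using split[OF fin(2), of "\<lambda>e. hd e \<noteq> 0"] by (simp add: T2_def conj_assoc)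
    moreover have "sum \<Omega> {e \<in> ?T. count_list e 0 = 2 \<and> hd e = 0} =
        sum \<Omega> {e \<in> ?T. count_list e 0 = 2 \<and> hd e = 0 \<and> hd (tl e) \<noteq> 0} +
        sum \<Omega> {e \<in> ?T. count_list e 0 = 2 \<and> hd e = 0 \<and> hd (tl e) = 0}"
      using split[of "{e \<in> ?T. count_list e 0 = 2 \<and> hd e = 0}" "\<lambda>e. hd (tl e) \<noteq> 0"]
      by (simp add: conj_assoc)
    ultimately show ?thesis
      unfolding n' using sum.reindex_bij_betw[OF bij_two_zeros, of \<Omega> k n']
        sum.reindex_bij_betw[OF bij_two_zeros_front, of \<Omega> k n']
        sum.reindex_bij_betw[OF bij_two_zeros_front_front, of \<Omega> k n']
      by (simp add: sum.Sigma case_prod_unfold add.assoc)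
  qed
  finally show ?thesis by (simp add: add_ac)
qed

section \<open>Effect of insertions on cuts, distinct entries and rank\<close>

lemma length_in_cuts: "f \<noteq> [] \<Longrightarrow> length f \<in> cuts f"
  by (simp add: cuts_def)

lemma zero_notin_cuts [simp]: "0 \<notin> cuts f"
  by (simp add: cuts_def)

lemma cuts_map_Suc [simp]: "cuts (map Suc f) = cuts f"
  by (auto simp: cuts_def take_map drop_map)

text \<open>A position beyond the zero has that zero in front of it, so only zeros may stand behind
  it.\<close>

lemma cuts_append_zero:
  "cuts (map Suc p @ 0 # t) =
     {q. 0 < q \<and> q \<le> length p \<and> (\<forall>a\<in>set (take q p). \<forall>b\<in>set (drop q p). b \<le> a) \<and>
         (\<forall>a\<in>set (take q p). \<forall>b\<in>set t. b \<le> Suc a)} \<union>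
     (\<lambda>j. length p + 1 + j) ` {j. j \<le> length t \<and> (\<forall>b\<in>set (drop j t). b = 0)}"
  (is "?l = ?A \<union> ?B")
proof (rule set_eqI)
  fix q
  show "q \<in> ?l \<longleftrightarrow> q \<in> ?A \<union> ?B"
  proof (cases "q \<le> length p")
    case True
    then have "q \<notin> ?B" by auto
    moreover have *: "take q (map Suc p @ 0 # t) = map Suc (take q p)"
      "drop q (map Suc p @ 0 # t) = map Suc (drop q p) @ 0 # t"
      and len: "q \<le> length (map Suc p @ 0 # t)"
      using True by (simp_all add: take_map drop_map)
    have aux: "(\<forall>a\<in>set (map Suc u). \<forall>b\<in>set (map Suc v @ 0 # t). b \<le> a) \<longleftrightarrow>
        (\<forall>a\<in>set u. \<forall>b\<in>set v. b \<le> a) \<and> (\<forall>a\<in>set u. \<forall>b\<in>set t. b \<le> Suc a)" for u v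
      by auto
    have "q \<in> ?l \<longleftrightarrow> q \<in> ?A"
      unfolding cuts_def mem_Collect_eq * aux by (simp only: True len simp_thms)
    ultimately show ?thesis by (simp only: Un_iff simp_thms)
  next
    case False
    then obtain j where j: "q = length p + 1 + j" using le_Suc_ex[of "length p + 1" q] by auto
    have "take q (map Suc p @ 0 # t) = map Suc p @ 0 # take j t"
      "drop q (map Suc p @ 0 # t) = drop j t" by (simp_all add: j)
    then have "q \<in> ?l \<longleftrightarrow> j \<le> length t \<and> (\<forall>b\<in>set (drop j t). b = 0)"
      unfolding cuts_def mem_Collect_eq by (auto simp: j)
    also have "\<dots> \<longleftrightarrow> q \<in> ?B" by (auto simp: j)
    finally show ?thesis using False by auto
  qed
qed

text \<open>The new zero destroys every cut after it except the end of the list, so insertion at the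
  i-th cut leaves \<open>i + 1\<close> cuts. The case \<open>q = 0\<close> covers leading
  zeros.\<close>

lemma cuts_insert_zero:
  assumes "q = 0 \<or> q \<in> cuts f"
  shows "cuts (insert_zero q f) = {q' \<in> cuts f. q' \<le> q} \<union> {Suc (length f)}"
proof -
  have q: "q \<le> length f" using assms cuts_le_length by blast
  \<comment> \<open>No entry of \<open>map Suc\<close> is zero, so only the empty suffix
    qualifies.\<close>
  have B: "{j. j \<le> length (map Suc (drop q f)) \<and> (\<forall>b\<in>set (drop j (map Suc (drop q f))). b = 0)}
      = {length f - q}"
    by (auto simp: drop_map)
  have A: "(\<forall>a\<in>set (take q' (take q f)). \<forall>b\<in>set (drop q' (take q f)). b \<le> a) \<and>
      (\<forall>a\<in>set (take q' (take q f)). \<forall>b\<in>set (map Suc (drop q f)). b \<le> Suc a) \<longleftrightarrow>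
      (\<forall>a\<in>set (take q' f). \<forall>b\<in>set (drop q' f). b \<le> a)" if "q' \<le> q" for q'
  proof -
    have "take q' (take q f) = take q' f" using that by (simp add: min_def)
    moreover have "set (drop q' f) = set (drop q' (take q f)) \<union> set (drop q f)"
      using take_drop_between[OF that, of f] by (metis set_append)
    ultimately show ?thesis by auto
  qed
  have "{q'. 0 < q' \<and> q' \<le> length (take q f) \<and>
        (\<forall>a\<in>set (take q' (take q f)). \<forall>b\<in>set (drop q' (take q f)). b \<le> a) \<and>
        (\<forall>a\<in>set (take q' (take q f)). \<forall>b\<in>set (map Suc (drop q f)). b \<le> Suc a)} =
      {q' \<in> cuts f. q' \<le> q}"
  proof (rule Collect_cong)
    fix q'
    have "length (take q f) = q" using q by simp
    moreover have "q' \<le> length f" if "q' \<le> q" using that q by simp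
    ultimately show "0 < q' \<and> q' \<le> length (take q f) \<and>
        (\<forall>a\<in>set (take q' (take q f)). \<forall>b\<in>set (drop q' (take q f)). b \<le> a) \<and>
        (\<forall>a\<in>set (take q' (take q f)). \<forall>b\<in>set (map Suc (drop q f)). b \<le> Suc a) \<longleftrightarrow>
        q' \<in> cuts f \<and> q' \<le> q"
      unfolding cuts_def mem_Collect_eq using A[of q'] by metis
  qed
  moreover have "length (take q f) + 1 + (length f - q) = Suc (length f)" using q by simp
  ultimately show ?thesis
    unfolding insert_zero_def cuts_append_zero B by simp
qed

text \<open>If the second zero is the last entry, the position just before it is a cut too, as only
  a zero follows. This extra cut is the source of the special role of
  \<open>r = length f\<close>.\<close>

lemma cuts_insert_zeros:
  assumes "q = 0 \<or> q \<in> cuts f" "r = 0 \<or> r \<in> cuts f" "q \<le> r"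
  shows "cuts (insert_zeros q r f) = {q' \<in> cuts f. q' \<le> q} \<union>
    (if r = length f then {Suc (length f), Suc (Suc (length f))} else {Suc (Suc (length f))})"
proof -
  have q: "q \<le> length f" "r \<le> length f" using assms cuts_le_length by blast+
  have B: "{j. j \<le> length (map Suc (drop q (take r f)) @ 0 # map Suc (drop r f)) \<and>
      (\<forall>b\<in>set (drop j (map Suc (drop q (take r f)) @ 0 # map Suc (drop r f))). b = 0)}
      = (if r = length f then {length f - q, Suc (length f - q)} else {Suc (length f - q)})"
    (is "?B = ?C")
  proof (rule set_eqI)
    fix j
    let ?m = "drop q (take r f)"
    have m: "length ?m = r - q" using q by simp
    show "j \<in> ?B \<longleftrightarrow> j \<in> ?C"
    proof (cases "j \<le> r - q")
      case True
      then have "drop j (map Suc ?m @ 0 # map Suc (drop r f)) =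
          map Suc (drop j ?m) @ 0 # map Suc (drop r f)"
        by (simp only: drop_append drop_map length_map m) simp
      moreover have "drop j ?m = [] \<longleftrightarrow> r - q \<le> j" using m by auto
      ultimately have "j \<in> ?B \<longleftrightarrow> j = r - q \<and> r = length f"
        using True m q by (cases "drop j ?m"; cases "drop r f"; auto)
      then show ?thesis using True q assms(3) by auto
    next
      case False
      then obtain i where i: "j = r - q + 1 + i" using le_Suc_ex[of "r - q + 1" j] by auto
      have "drop j (map Suc ?m @ 0 # map Suc (drop r f)) = drop i (map Suc (drop r f))"
        by (simp only: drop_append drop_map length_map m) (use m in \<open>simp add: i drop_map\<close>)
      then have "j \<in> ?B \<longleftrightarrow> i = length f - r"
        using m q by (auto simp: drop_map i)
      then show ?thesis using q assms(3) i by auto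
    qed
  qed
  have A: "(\<forall>a\<in>set (take q' (take q f)). \<forall>b\<in>set (drop q' (take q f)). b \<le> a) \<and>
      (\<forall>a\<in>set (take q' (take q f)).
        \<forall>b\<in>set (map Suc (drop q (take r f)) @ 0 # map Suc (drop r f)). b \<le> Suc a) \<longleftrightarrow>
      (\<forall>a\<in>set (take q' f). \<forall>b\<in>set (drop q' f). b \<le> a)" if "q' \<le> q" for q'
  proof -
    have "take q' (take q f) = take q' f" using that by (simp add: min_def)
    moreover have "set (drop q' f) =
        set (drop q' (take q f)) \<union> (set (drop q (take r f)) \<union> set (drop r f))"
      using take_drop_between[OF that, of f] take_drop_between[OF assms(3), of f]
      by (metis set_append)
    moreover have "(\<forall>a\<in>T. \<forall>b\<in>set (map Suc m @ 0 # map Suc s). b \<le> Suc a) \<longleftrightarrow>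
        (\<forall>a\<in>T. \<forall>b\<in>set m \<union> set s. b \<le> a)" for T m s by auto
    ultimately show ?thesis by (simp only: ball_Un) blast
  qed
  define X where "X = (\<lambda>q'. (\<forall>a\<in>set (take q' (take q f)). \<forall>b\<in>set (drop q' (take q f)). b \<le> a))"
  define Y where "Y = (\<lambda>q'. (\<forall>a\<in>set (take q' (take q f)).
    \<forall>b\<in>set (map Suc (drop q (take r f)) @ 0 # map Suc (drop r f)). b \<le> Suc a))"
  have len: "length (take q f) = q" using q by simp
  define Z where "Z = (\<lambda>q'. (\<forall>a\<in>set (take q' f). \<forall>b\<in>set (drop q' f). b \<le> a))"
  have A': "X q' \<and> Y q' \<longleftrightarrow> Z q'" if "q' \<le> q" for q'
    unfolding X_def Y_def Z_def by (rule A[OF that])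
  have "{q'. 0 < q' \<and> q' \<le> q \<and> X q' \<and> Y q'} = {q'. (0 < q' \<and> q' \<le> length f \<and> Z q') \<and> q' \<le> q}"
    using A' q(1) by auto
  then have "{q'. 0 < q' \<and> q' \<le> q \<and> X q' \<and> Y q'} = {q' \<in> cuts f. q' \<le> q}"
    unfolding cuts_def mem_Collect_eq Z_def .
  moreover have "q + 1 + (length f - q) = Suc (length f)"
    "q + 1 + Suc (length f - q) = Suc (Suc (length f))" using q by simp_all
  ultimately show ?thesis
    unfolding insert_zeros_def cuts_append_zero B len X_def Y_def by simp
qed

lemma card_cuts_insert_zero:
  assumes "q = 0 \<or> q \<in> cuts f"
  shows "card (cuts (insert_zero q f)) = Suc (card {q' \<in> cuts f. q' \<le> q})"
proof -
  have "{q' \<in> cuts f. q' \<le> q} \<inter> {Suc (length f)} = {}" using cuts_le_length by fastforce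
  then show ?thesis unfolding cuts_insert_zero[OF assms] by (subst card_Un_disjoint) auto
qed

lemma card_cuts_insert_zeros:
  assumes "q = 0 \<or> q \<in> cuts f" "r = 0 \<or> r \<in> cuts f" "q \<le> r"
  shows "card (cuts (insert_zeros q r f)) =
    Suc (card {q' \<in> cuts f. q' \<le> q}) + (if r = length f then 1 else 0)"
proof -
  have "{q' \<in> cuts f. q' \<le> q} \<inter> {Suc (length f), Suc (Suc (length f))} = {}"
    using cuts_le_length by fastforce
  then show ?thesis unfolding cuts_insert_zeros[OF assms] by (subst card_Un_disjoint) auto
qed

lemma card_set_insert_zero [simp]: "card (set (insert_zero q f)) = Suc (card (set f))"
proof -
  have "set (insert_zero q f) = insert 0 (Suc ` set f)"
    unfolding insert_zero_def by (metis (no_types, lifting) Un_insert_right append_take_drop_id list.simps(15) set_append set_map image_Un)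
  then show ?thesis by (simp add: card_image)
qed

lemma card_set_insert_zeros [simp]:
  assumes "q \<le> r"
  shows "card (set (insert_zeros q r f)) = Suc (card (set f))"
proof -
  have "set f = set (take q f) \<union> (set (drop q (take r f)) \<union> set (drop r f))"
    by (metis append_take_drop_id set_append take_drop_between[OF assms])
  then have "set (insert_zeros q r f) = insert 0 (Suc ` set f)"
    unfolding insert_zeros_def by auto
  then show ?thesis by (simp add: card_image)
qed

lemma shifted_rank_map_Suc [simp]:
  "f \<noteq> [] \<Longrightarrow> shifted_rank (Suc k) (map Suc f) = shifted_rank k f"
  by (induction k f rule: shifted_rank.induct) auto

text \<open>The zero makes the end of \<open>p\<close> a descent, exactly as the end-of-list
  convention does for \<open>p\<close> alone.\<close>

lemma shifted_rank_append_zero: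
  "p \<noteq> [] \<Longrightarrow> shifted_rank (Suc k) (map Suc p @ 0 # t) = shifted_rank k p"
  by (induction k p rule: shifted_rank.induct) auto

lemma shifted_rank_Cons_zero: "t \<noteq> [] \<Longrightarrow> shifted_rank k (0 # t) = shifted_rank (Suc k) t"
  by (cases t) auto

text \<open>If the initial weakly increasing run covers \<open>p\<close> and continues into
  \<open>s\<close>, then \<open>p\<close> is constant with value \<open>hd s\<close>. At most two
  copies of a value are allowed, so \<open>p\<close> has length 1 and the run gains exactly one
  place.\<close>

lemma shifted_rank_append_below:
  assumes "p \<noteq> []" "bounded_from k p" "\<forall>a\<in>set p. \<forall>c\<in>set s. c \<le> a" "\<forall>v. count_list (p @ s) v \<le> 2"
  shows "shifted_rank k (p @ s) =
    shifted_rank k p + (if length p = 1 \<and> s \<noteq> [] \<and> hd s = hd p then 1 else 0)"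
  using assms
proof (induction k p rule: shifted_rank.induct)
  case (2 k a)
  show ?case
  proof (cases s)
    case (Cons b s')
    show ?thesis
    proof (cases "b = a")
      case True
      \<comment> \<open>A third copy of \<open>a\<close> is excluded, so the run stops at the second
        one.\<close>
      have "count_list s' a = 0"
        using 2(4) True Cons by (metis append_Cons append_Nil count_list.simps(2) add_is_1 le_Suc_eq numeral_2_eq_2 Suc_le_mono add.commute plus_1_eq_Suc le_zero_eq)
      then have "shifted_rank (Suc k) (a # s') = k - a"
        using 2(3) Cons by (cases s') (auto simp: le_neq_implies_less)
      then show ?thesis using True Cons 2(2) by auto
    next
      case False
      then show ?thesis using Cons 2(3) by auto
    qed
  qed simp
next
  case (3 k a b p)
  show ?case
  proof (cases "b < a")
    case False
    have "\<forall>v. count_list ((b # p) @ s) v \<le> 2" using 3(5)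
      by (metis append_Cons count_list.simps(2) le_add1 le_trans)
    then have "shifted_rank (Suc k) ((b # p) @ s) =
      shifted_rank (Suc k) (b # p) + (if length (b # p) = 1 \<and> s \<noteq> [] \<and> hd s = hd (b # p) then 1 else 0)"
      using 3(1)[OF False] 3(3,4) by auto
    moreover have "\<not> (length (b # p) = 1 \<and> s \<noteq> [] \<and> hd s = hd (b # p))"
    proof
      assume *: "length (b # p) = 1 \<and> s \<noteq> [] \<and> hd s = hd (b # p)"
      then obtain s' where "s = b # s'" "p = []" by (cases s) auto
      moreover from this have "a = b" using 3(4) False by auto
      ultimately have "2 < count_list ((a # b # p) @ s) a" by simp
      then show False using 3(5) by (metis not_le)
    qed
    ultimately show ?thesis using False by simp
  qed simp
qed simp

text \<open>The only case in which inserting a non-initial zero changes the rank: a zero between the two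
  equal initial entries creates an earlier first descent.\<close>

definition doubled_peak :: "nat list \<Rightarrow> bool" where
  "doubled_peak f \<longleftrightarrow> (\<exists>a s. f = a # a # s \<and> (\<forall>b\<in>set s. b < a))"

text \<open>Removing one of the two equal heads of a doubled peak leaves a sequence of this kind.
  The class has a recurrence of its own, in which no rank correction occurs.\<close>

definition peaked :: "nat list \<Rightarrow> bool" where
  "peaked f \<longleftrightarrow> (\<exists>a s. f = a # s \<and> (\<forall>b\<in>set s. b < a))"

text \<open>The rank of \<open>take q f\<close> is the rank after a zero has been inserted at
  \<open>q\<close>, so this measures the loss of rank.\<close>

lemma shifted_rank_take_cut:
  assumes "f \<in> avoiders k" "q \<in> cuts f"
  shows "shifted_rank k f = shifted_rank k (take q f) + (if q = 1 \<and> doubled_peak f then 1 else 0)"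
proof -
  have ne: "take q f \<noteq> []" using assms(2) by (auto simp: cuts_def)
  have cnt: "\<forall>v. count_list f v \<le> 2" using assms(1) by (simp add: avoiders_def)
  have cut: "\<forall>a\<in>set (take q f). \<forall>c\<in>set (drop q f). c \<le> a" using assms(2) unfolding cuts_def by blast
  have "bounded_from k (take q f @ drop q f)" using assms(1) by (simp add: avoiders_def)
  then have "bounded_from k (take q f)" unfolding bounded_from_append by blast
  then have *: "shifted_rank k f = shifted_rank k (take q f) +
     (if length (take q f) = 1 \<and> drop q f \<noteq> [] \<and> hd (drop q f) = hd (take q f) then 1 else 0)"
    using shifted_rank_append_below[of "take q f" k "drop q f"] ne cut cnt
    unfolding append_take_drop_id by blast
  have "length (take q f) = 1 \<and> drop q f \<noteq> [] \<and> hd (drop q f) = hd (take q f) \<longleftrightarrow>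
      q = 1 \<and> doubled_peak f" (is "?l \<longleftrightarrow> ?r")
  proof
    assume l: ?l
    then have q: "q = 1" using cuts_le_length[OF assms(2)] by simp
    obtain a s where f: "f = a # a # s" using l unfolding q by (cases f; cases "tl f") auto
    have "b < a" if "b \<in> set s" for b
    proof -
      have "b \<le> a" using cut that unfolding f q by auto
      moreover have "b \<noteq> a"
      proof
        assume "b = a"
        then have "count_list s a \<noteq> 0" using that by (simp add: count_list_0_iff)
        then have "2 < count_list f a" unfolding f by simp
        then show False using cnt by (metis not_le)
      qed
      ultimately show ?thesis by simp
    qed
    then show ?r unfolding doubled_peak_def using f q by blast
  next
    assume ?r
    then show ?l by (auto simp: doubled_peak_def)
  qed
  then show ?thesis using * by simp
qed

lemma shifted_rank_insert_zero:
  assumes "f \<in> avoiders k" "q \<in> cuts f"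
  shows "shifted_rank (Suc k) (insert_zero q f) =
    shifted_rank k f - (if q = 1 \<and> doubled_peak f then 1 else 0)"
proof -
  have "take q f \<noteq> []" using assms(2) by (auto simp: cuts_def)
  then show ?thesis
    unfolding insert_zero_def shifted_rank_take_cut[OF assms]
    by (simp add: shifted_rank_append_zero)
qed

lemma shifted_rank_insert_zeros:
  assumes "f \<in> avoiders k" "q \<in> cuts f"
  shows "shifted_rank (Suc k) (insert_zeros q r f) =
    shifted_rank k f - (if q = 1 \<and> doubled_peak f then 1 else 0)"
proof -
  have "take q f \<noteq> []" using assms(2) by (auto simp: cuts_def)
  then show ?thesis
    unfolding insert_zeros_def shifted_rank_take_cut[OF assms]
    by (simp add: shifted_rank_append_zero)
qed

text \<open>For \<open>f = []\<close> this rests on the default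
  \<open>shifted_rank k [] = k - 1\<close>.\<close>

lemma shifted_rank_zero_map_Suc:
  "shifted_rank (Suc k) (0 # map Suc f) = shifted_rank (Suc k) f"
  by (cases "f = []") (auto simp: shifted_rank_Cons_zero)

lemma shifted_rank_zero_zero_map_Suc:
  "shifted_rank (Suc k) (0 # 0 # map Suc f) = shifted_rank (Suc (Suc k)) f"
  by (simp add: shifted_rank_Cons_zero shifted_rank_zero_map_Suc)

section \<open>Doubled peaks and peaked sequences\<close>

lemma doubled_peak_cuts:
  "cuts (a # a # s) = insert 1 (Suc ` cuts (a # s))" if "\<forall>b\<in>set s. b < a"
proof (rule set_eqI)
  fix q
  show "q \<in> cuts (a # a # s) \<longleftrightarrow> q \<in> insert 1 (Suc ` cuts (a # s))"
  proof (cases q)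
    case (Suc q')
    show ?thesis
    proof (cases q')
      case 0
      then show ?thesis using Suc that by (auto simp: cuts_def less_imp_le)
    next
      case (Suc q'')
      then show ?thesis using \<open>q = Suc q'\<close> by (auto simp: cuts_def image_iff)
    qed
  qed auto
qed

lemma avoids_102_Cons_max: "\<forall>b\<in>set s. b \<le> z \<Longrightarrow> avoids_102 (z # s) \<longleftrightarrow> avoids_102 s"
proof -
  have "subseq [b, c] s \<Longrightarrow> c \<in> set s" for b c
    by (metis subseq_Cons' subseq_singleton_left)
  then show "\<forall>b\<in>set s. b \<le> z \<Longrightarrow> avoids_102 (z # s) \<longleftrightarrow> avoids_102 s"
    using subseq3_insert[of _ _ _ "[]" z s] unfolding avoids_102_iff_subseq by (auto simp: not_less)
qed

lemma bij_doubled_peak: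
  "bij_betw (\<lambda>p. hd p # p) {p \<in> avoiders_of_length k n. peaked p}
     {f \<in> avoiders_of_length k (Suc n). doubled_peak f}"
proof (rule bij_betw_imageI)
  show "inj_on (\<lambda>p. hd p # p) {p \<in> avoiders_of_length k n. peaked p}" by (simp add: inj_on_def)
  have *: "a # a # s \<in> avoiders k \<longleftrightarrow> a # s \<in> avoiders k" if s: "\<forall>b\<in>set s. b < a" for a s
  proof -
    have "avoids_102 (a # a # s) \<longleftrightarrow> avoids_102 (a # s)"
      using s by (intro avoids_102_Cons_max) auto
    moreover have "(\<forall>v. count_list (a # a # s) v \<le> 2) \<longleftrightarrow> (\<forall>v. count_list (a # s) v \<le> 2)"
    proof -
      have "count_list s a = 0" using s by (auto simp: count_list_0_iff)
      then have "count_list (a # a # s) v \<le> 2 \<longleftrightarrow> count_list (a # s) v \<le> 2" for v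
        by (cases "v = a") auto
      then show ?thesis by blast
    qed
    moreover have "a < k \<Longrightarrow> bounded_from k' s" if "k \<le> k'" for k'
      using s that by (intro bounded_from_bound) (meson less_le_trans less_trans)
    then have "bounded_from k (a # a # s) \<longleftrightarrow> bounded_from k (a # s)" by auto
    ultimately show ?thesis unfolding avoiders_def by blast
  qed
  show "(\<lambda>p. hd p # p) ` {p \<in> avoiders_of_length k n. peaked p} =
     {f \<in> avoiders_of_length k (Suc n). doubled_peak f}" (is "?l = ?r")
  proof
    show "?l \<subseteq> ?r"
      using * by (auto simp: avoiders_of_length_def peaked_def doubled_peak_def)
    show "?r \<subseteq> ?l"
    proof
      fix f assume "f \<in> ?r"
      then obtain a s where f: "f = a # a # s" "\<forall>b\<in>set s. b < a" "f \<in> avoiders k" "length f = Suc n"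
        by (auto simp: avoiders_of_length_def doubled_peak_def)
      then have "a # s \<in> {p \<in> avoiders_of_length k n. peaked p}"
        using * by (auto simp: avoiders_of_length_def peaked_def)
      moreover have "f = hd (a # s) # (a # s)" using f by simp
      ultimately show "f \<in> ?l" by (metis (no_types, lifting) image_eqI)
    qed
  qed
qed

lemma peaked_map_Suc [simp]: "peaked (map Suc f) \<longleftrightarrow> peaked f"
  by (cases f) (auto simp: peaked_def)

lemma peaked_append_zero:
  "p \<noteq> [] \<Longrightarrow> peaked (map Suc p @ 0 # t) \<longleftrightarrow> peaked (map Suc p @ t)"
  by (cases p) (auto simp: peaked_def)

lemma peaked_insert_zero: "q \<in> cuts f \<Longrightarrow> peaked (insert_zero q f) \<longleftrightarrow> peaked f"
proof -
  assume "q \<in> cuts f"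
  then have "take q f \<noteq> []" by (auto simp: cuts_def)
  then have "peaked (insert_zero q f) \<longleftrightarrow> peaked (map Suc (take q f @ drop q f))"
    unfolding insert_zero_def by (simp only: peaked_append_zero map_append not_False_eq_True)
  then show ?thesis by (simp only: append_take_drop_id peaked_map_Suc)
qed

lemma peaked_insert_zeros:
  assumes "q \<in> cuts f" "q \<le> r"
  shows "peaked (insert_zeros q r f) \<longleftrightarrow> peaked f"
proof -
  have 1: "take q f \<noteq> []" using assms(1) by (auto simp: cuts_def)
  then have "take q f @ drop q (take r f) \<noteq> []" by simp
  then have 2: "peaked (map Suc (take q f @ drop q (take r f)) @ 0 # map Suc (drop r f)) \<longleftrightarrow>
      peaked (map Suc (take q f @ drop q (take r f)) @ map Suc (drop r f))"
    by (rule peaked_append_zero)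
  have "peaked (insert_zeros q r f) \<longleftrightarrow>
      peaked (map Suc (take q f) @ map Suc (drop q (take r f)) @ 0 # map Suc (drop r f))"
    unfolding insert_zeros_def by (rule peaked_append_zero[OF 1])
  also have "\<dots> \<longleftrightarrow> peaked (map Suc (take q f @ drop q (take r f) @ drop r f))"
    using 2 by (simp only: map_append append_assoc)
  also have "take q f @ drop q (take r f) @ drop r f = f"
    by (simp only: take_drop_between[OF assms(2)] append_take_drop_id)
  finally show ?thesis by simp
qed

lemma peaked_Cons_zero [simp]: "peaked (0 # t) \<longleftrightarrow> t = []"
  by (cases t) (auto simp: peaked_def)

section \<open>Recurrences for weighted sums\<close>

lemma cuts_Nil [simp]: "cuts [] = {}"
  by (auto simp: cuts_def)

text \<open>The cardinality is the index of \<open>q\<close> in the increasing enumeration of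
  \<open>A\<close>, so it takes each value from 1 to \<open>card A\<close> once.\<close>

lemma sum_card_le:
  fixes A :: "nat set" and h :: "nat \<Rightarrow> 'a::comm_monoid_add"
  assumes "finite A"
  shows "(\<Sum>q\<in>A. h (card {q' \<in> A. q' \<le> q})) = (\<Sum>i=1..card A. h i)"
  using assms
proof (induction A rule: finite_linorder_max_induct)
  case (insert b A)
  have "b \<notin> A" using insert by blast
  have "{q' \<in> insert b A. q' \<le> q} = {q' \<in> A. q' \<le> q}" if "q \<in> A" for q
    using insert that by force
  then have "(\<Sum>q\<in>A. h (card {q' \<in> insert b A. q' \<le> q})) = (\<Sum>i=1..card A. h i)"
    unfolding insert.IH[symmetric] by (intro sum.cong) simp_all
  moreover have "{q' \<in> insert b A. q' \<le> b} = insert b A" using insert by force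
  ultimately show ?case using insert.hyps \<open>b \<notin> A\<close> by (simp add: add.commute)
qed simp

lemma card_cuts_above:
  assumes "q \<in> cuts f"
  shows "card {r \<in> cuts f. q \<le> r} = Suc (card (cuts f) - card {q' \<in> cuts f. q' \<le> q})"
proof -
  have 1: "cuts f = {q' \<in> cuts f. q' \<le> q} \<union> {r \<in> cuts f. q < r}" by auto
  have "card (cuts f) = card {q' \<in> cuts f. q' \<le> q} + card {r \<in> cuts f. q < r}"
    by (subst 1, subst card_Un_disjoint) auto
  moreover have "{r \<in> cuts f. q \<le> r} = insert q {r \<in> cuts f. q < r}" using assms by auto
  ultimately show ?thesis by simp
qed

lemma sum_end_cut:
  fixes x w :: "'a::comm_ring_1"
  assumes "f \<noteq> []" "C \<subseteq> cuts f" "length f \<in> C"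
  shows "(\<Sum>r\<in>C. if r = length f then x else w) = of_nat (card C - 1) * w + x"
proof -
  have fin: "finite C" using assms(2) by (rule finite_subset) simp
  have "(\<Sum>r\<in>C. if r = length f then x else w) = x + (\<Sum>r\<in>C - {length f}. w)"
    using assms(3) fin by (simp add: sum.remove[of C "length f"])
  then show ?thesis using assms(3) fin by (simp add: card_Diff_singleton)
qed

lemma doubled_peak_one_in_cuts: "doubled_peak f \<Longrightarrow> 1 \<in> cuts f"
  by (auto simp: doubled_peak_def doubled_peak_cuts)

text \<open>Only the cut at 1 of a doubled peak loses a unit of rank; that summand is corrected
  separately.\<close>

lemma sum_cuts_rank:
  fixes z :: "'a::comm_ring_1"
  shows "(\<Sum>q\<in>cuts f. z ^ (r - (if q = 1 \<and> doubled_peak f then 1 else 0)) * K q) =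
    z ^ r * (\<Sum>q\<in>cuts f. K q) + (if doubled_peak f then (z ^ (r - 1) - z ^ r) * K 1 else 0)"
proof (cases "doubled_peak f")
  case True
  have "(\<Sum>q\<in>cuts f. z ^ (r - (if q = 1 \<and> doubled_peak f then 1 else 0)) * K q) =
     z ^ (r - 1) * K 1 + (\<Sum>q\<in>cuts f - {1}. z ^ r * K q)"
    using True doubled_peak_one_in_cuts[OF True]
    by (subst sum.remove[of _ 1]) (auto intro!: sum.cong)
  moreover have "z ^ r * (\<Sum>q\<in>cuts f. K q) = z ^ r * K 1 + (\<Sum>q\<in>cuts f - {1}. z ^ r * K q)"
    using doubled_peak_one_in_cuts[OF True]
    by (subst sum.remove[of _ 1]) (auto simp: sum_distrib_left distrib_left)
  ultimately show ?thesis using True by (simp add: algebra_simps)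
qed (simp add: sum_distrib_left)

lemma card_le_one_cut: "1 \<in> cuts f \<Longrightarrow> card {q' \<in> cuts f. q' \<le> 1} = 1"
proof -
  assume "1 \<in> cuts f"
  then have "{q' \<in> cuts f. q' \<le> 1} = {1}" by (auto simp: le_Suc_eq)
  then show ?thesis by simp
qed

text \<open>One zero placed at the i-th of \<open>\<tau>\<close> cuts leaves \<open>i + 1\<close>
  cuts; \<open>h\<close> is the weight of a number of cuts.\<close>

definition insertions1 :: "(nat \<Rightarrow> 'a::comm_ring_1) \<Rightarrow> nat \<Rightarrow> 'a" where
  "insertions1 h \<tau> = (\<Sum>i=1..\<tau>. h (Suc i))"

text \<open>With the first zero at the i-th cut, the second has \<open>\<tau> - i\<close> places
  other than the end, each leaving \<open>i + 1\<close> cuts; at the end it leaves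
  \<open>i + 2\<close>.\<close>

definition insertions2 :: "(nat \<Rightarrow> 'a::comm_ring_1) \<Rightarrow> nat \<Rightarrow> 'a" where
  "insertions2 h \<tau> = (\<Sum>i=1..\<tau>. of_nat (\<tau> - i) * h (Suc i) + h (Suc (Suc i)))"

text \<open>A function \<open>h\<close> replaces the catalytic variable: \<open>u ^ \<tau>\<close>
  gives the generating function at \<open>u\<close>, the constant 1 its value at 1, and
  \<open>\<tau>\<close> its derivative at 1.\<close>

definition weight :: "'a::comm_ring_1 \<Rightarrow> 'a \<Rightarrow> nat \<Rightarrow> (nat \<Rightarrow> 'a) \<Rightarrow> nat list \<Rightarrow> 'a" where
  "weight y z k h e = y ^ card (set e) * z ^ shifted_rank k e * h (card (cuts e))"

lemma weight_map_Suc: "f \<noteq> [] \<Longrightarrow> weight y z (Suc k) h (map Suc f) = weight y z k h f"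
  by (simp add: weight_def card_image)

lemma weight_insert_zero:
  assumes "f \<in> avoiders k"
  shows "(\<Sum>q\<in>cuts f. weight y z (Suc k) h (insert_zero q f)) =
    y * (weight y z k (insertions1 h) f +
      (if doubled_peak f then y ^ card (set f) *
         (z ^ (shifted_rank k f - 1) - z ^ shifted_rank k f) * h 2 else 0))"
proof -
  have "(\<Sum>q\<in>cuts f. weight y z (Suc k) h (insert_zero q f)) = (\<Sum>q\<in>cuts f.
      y ^ Suc (card (set f)) * (z ^ (shifted_rank k f - (if q = 1 \<and> doubled_peak f then 1 else 0)) *
        h (Suc (card {q' \<in> cuts f. q' \<le> q}))))"
    by (rule sum.cong)
      (simp_all add: weight_def shifted_rank_insert_zero[OF assms] card_cuts_insert_zero mult.assoc)
  also have "\<dots> = y ^ Suc (card (set f)) * (z ^ shifted_rank k f * insertions1 h (card (cuts f)) +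
      (if doubled_peak f then (z ^ (shifted_rank k f - 1) - z ^ shifted_rank k f) * h 2 else 0))"
    unfolding sum_distrib_left[symmetric] sum_cuts_rank insertions1_def
      sum_card_le[OF finite_cuts, of "\<lambda>i. h (Suc i)"]
    \<comment> \<open>Position 1 is the first cut, so the corrected summand has index 1 and leaves
      two cuts.\<close>
    using card_le_one_cut[OF doubled_peak_one_in_cuts[of f]] by (simp add: numeral_2_eq_2)
  finally show ?thesis by (simp add: weight_def algebra_simps)
qed

lemma weight_insert_zeros:
  assumes "f \<in> avoiders k"
  shows "(\<Sum>q\<in>cuts f. \<Sum>r\<in>{r \<in> cuts f. q \<le> r}. weight y z (Suc k) h (insert_zeros q r f)) =
    y * (weight y z k (insertions2 h) f +
      (if doubled_peak f then y ^ card (set f) *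
         (z ^ (shifted_rank k f - 1) - z ^ shifted_rank k f) *
         (of_nat (card (cuts f) - 1) * h 2 + h 3) else 0))"
proof -
  let ?i = "\<lambda>q. card {q' \<in> cuts f. q' \<le> q}"
  let ?K = "\<lambda>i. of_nat (card (cuts f) - i) * h (Suc i) + h (Suc (Suc i))"
  have "(\<Sum>r\<in>{r \<in> cuts f. q \<le> r}. weight y z (Suc k) h (insert_zeros q r f)) =
      y ^ Suc (card (set f)) * (z ^ (shifted_rank k f - (if q = 1 \<and> doubled_peak f then 1 else 0)) *
        ?K (?i q))" if q: "q \<in> cuts f" for q
  proof -
    have f: "f \<noteq> []" using q by (auto simp: cuts_def)
    have "(\<Sum>r\<in>{r \<in> cuts f. q \<le> r}. weight y z (Suc k) h (insert_zeros q r f)) =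
      (\<Sum>r\<in>{r \<in> cuts f. q \<le> r}. y ^ Suc (card (set f)) *
         (z ^ (shifted_rank k f - (if q = 1 \<and> doubled_peak f then 1 else 0)) *
           (if r = length f then h (Suc (Suc (?i q))) else h (Suc (?i q)))))"
      by (rule sum.cong) (use q in \<open>simp_all add: weight_def shifted_rank_insert_zeros[OF assms q]
          card_cuts_insert_zeros mult.assoc\<close>)
    also have "(\<Sum>r\<in>{r \<in> cuts f. q \<le> r}.
          if r = length f then h (Suc (Suc (?i q))) else h (Suc (?i q))) = ?K (?i q)"
      using f length_in_cuts[OF f] cuts_le_length[OF q]
      by (subst sum_end_cut) (simp_all add: card_cuts_above[OF q])
    ultimately show ?thesis by (simp only: sum_distrib_left[symmetric])
  qed
  then have "(\<Sum>q\<in>cuts f. \<Sum>r\<in>{r \<in> cuts f. q \<le> r}. weight y z (Suc k) h (insert_zeros q r f)) =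
      (\<Sum>q\<in>cuts f. y ^ Suc (card (set f)) *
        (z ^ (shifted_rank k f - (if q = 1 \<and> doubled_peak f then 1 else 0)) * ?K (?i q)))"
    by (rule sum.cong[OF refl])
  also have "\<dots> = y ^ Suc (card (set f)) * (z ^ shifted_rank k f * insertions2 h (card (cuts f)) +
      (if doubled_peak f then (z ^ (shifted_rank k f - 1) - z ^ shifted_rank k f) *
         (of_nat (card (cuts f) - 1) * h 2 + h 3) else 0))"
    unfolding sum_distrib_left[symmetric] sum_cuts_rank insertions2_def
      sum_card_le[OF finite_cuts, of ?K]
    using card_le_one_cut[OF doubled_peak_one_in_cuts[of f]]
    by (simp add: numeral_2_eq_2 numeral_3_eq_3)
  finally show ?thesis by (simp add: weight_def algebra_simps)
qed

lemma Cons_zero_insert_zero: "0 # insert_zero r f = insert_zeros 0 r f"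
  by (simp add: insert_zero_def insert_zeros_def)

text \<open>Behind a leading zero no cut of \<open>f\<close> survives: one cut is left, or two if
  the second zero comes last.\<close>

lemma weight_zero_insert_zero:
  assumes "f \<in> avoiders (Suc k)"
  shows "(\<Sum>r\<in>cuts f. weight y z (Suc k) h (0 # insert_zero r f)) =
    y * ((if f = [] then 0 else weight y z (Suc k) (\<lambda>\<tau>. of_nat (\<tau> - 1) * h 1 + h 2) f) +
      (if doubled_peak f then y ^ card (set f) *
         (z ^ (shifted_rank (Suc k) f - 1) - z ^ shifted_rank (Suc k) f) * h 1 else 0))"
proof (cases "f = []")
  case True
  then show ?thesis by (simp add: doubled_peak_def)
next
  case f: False
  let ?K = "\<lambda>r. if r = length f then h 2 else h 1"
  have "shifted_rank (Suc k) (0 # insert_zero r f) = shifted_rank (Suc k) f -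
      (if r = 1 \<and> doubled_peak f then 1 else 0)" if "r \<in> cuts f" for r
    using shifted_rank_insert_zero[OF assms that]
    by (subst shifted_rank_Cons_zero) (simp_all add: insert_zero_def)
  moreover have "card (cuts (0 # insert_zero r f)) = (if r = length f then 2 else 1)"
    if "r \<in> cuts f" for r
    unfolding Cons_zero_insert_zero using that by (subst card_cuts_insert_zeros) auto
  moreover have "card (set (0 # insert_zero r f)) = Suc (card (set f))" for r
    unfolding Cons_zero_insert_zero by simp
  ultimately have "(\<Sum>r\<in>cuts f. weight y z (Suc k) h (0 # insert_zero r f)) =
      (\<Sum>r\<in>cuts f. y ^ Suc (card (set f)) *
       (z ^ (shifted_rank (Suc k) f - (if r = 1 \<and> doubled_peak f then 1 else 0)) * ?K r))"
    by (intro sum.cong) (simp_all add: weight_def mult.assoc)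
  also have "\<dots> = y ^ Suc (card (set f)) * (z ^ shifted_rank (Suc k) f * (\<Sum>r\<in>cuts f. ?K r) +
      (if doubled_peak f then
         (z ^ (shifted_rank (Suc k) f - 1) - z ^ shifted_rank (Suc k) f) * ?K 1 else 0))"
    unfolding sum_distrib_left[symmetric] sum_cuts_rank ..
  also have "(\<Sum>r\<in>cuts f. ?K r) = of_nat (card (cuts f) - 1) * h 1 + h 2"
    using f length_in_cuts[OF f] by (intro sum_end_cut) auto
  \<comment> \<open>A doubled peak has at least two entries, so its cut at 1 is not the end.\<close>
  also have "(if doubled_peak f then
         (z ^ (shifted_rank (Suc k) f - 1) - z ^ shifted_rank (Suc k) f) * ?K 1 else 0) =
      (if doubled_peak f then
         (z ^ (shifted_rank (Suc k) f - 1) - z ^ shifted_rank (Suc k) f) * h 1 else 0)"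
    by (auto simp: doubled_peak_def)
  finally show ?thesis using f by (simp add: weight_def algebra_simps)
qed

lemma weight_zero_map_Suc:
  "weight y z (Suc k) h (0 # map Suc f) = y * weight y z (Suc k) (\<lambda>_. h 1) f"
proof -
  have eq: "0 # map Suc f = insert_zero 0 f" by (simp add: insert_zero_def)
  have "card (cuts (insert_zero 0 f)) = 1" by (subst card_cuts_insert_zero) auto
  moreover have "shifted_rank (Suc k) (insert_zero 0 f) = shifted_rank (Suc k) f"
    using shifted_rank_zero_map_Suc by (simp add: insert_zero_def)
  ultimately show ?thesis unfolding eq by (simp add: weight_def)
qed

lemma weight_zero_zero_map_Suc:
  "weight y z (Suc k) h (0 # 0 # map Suc f) =
     y * weight y z (Suc (Suc k)) (\<lambda>_. if f = [] then h 2 else h 1) f"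
proof -
  have eq: "0 # 0 # map Suc f = insert_zeros 0 0 f" by (simp add: insert_zeros_def)
  have "card (cuts (insert_zeros 0 0 f)) = (if f = [] then 2 else 1)"
    by (subst card_cuts_insert_zeros) auto
  moreover have "shifted_rank (Suc k) (insert_zeros 0 0 f) = shifted_rank (Suc (Suc k)) f"
    using shifted_rank_zero_zero_map_Suc by (simp add: insert_zeros_def)
  ultimately show ?thesis unfolding eq by (simp add: weight_def)
qed

definition weight_sum ::
    "(nat list \<Rightarrow> bool) \<Rightarrow> 'a::comm_ring_1 \<Rightarrow> 'a \<Rightarrow> nat \<Rightarrow> nat \<Rightarrow> (nat \<Rightarrow> 'a) \<Rightarrow> 'a" where
  "weight_sum Q y z k n h = (\<Sum>e\<in>avoiders_of_length k n. if Q e then weight y z k h e else 0)"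

lemma avoiders_of_length_0 [simp]: "avoiders_of_length k 0 = {[]}"
  by (auto simp: avoiders_of_length_def avoiders_def avoids_102_def)

text \<open>Removing one copy of the head lowers the rank and the number of cuts by 1 and keeps the
  set of entries. The difference of two powers of \<open>z\<close> thereby becomes
  \<open>1 - z\<close> times the weight of the shorter sequence.\<close>

lemma sum_doubled_peak:
  "(\<Sum>f\<in>avoiders_of_length k n. if doubled_peak f then y ^ card (set f) *
      (z ^ (shifted_rank k f - 1) - z ^ shifted_rank k f) * h (card (cuts f)) else 0) =
   (if 1 \<le> n then (1 - z) * weight_sum peaked y z k (n - 1) (\<lambda>\<tau>. h (Suc \<tau>)) else 0)"
proof (cases n)
  case 0
  then show ?thesis by (simp add: doubled_peak_def)
next
  case (Suc m)
  let ?g = "\<lambda>f. y ^ card (set f) * (z ^ (shifted_rank k f - 1) - z ^ shifted_rank k f) * h (card (cuts f))"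
  have "(\<Sum>f\<in>avoiders_of_length k n. if doubled_peak f then ?g f else 0) =
      (\<Sum>f\<in>{f \<in> avoiders_of_length k (Suc m). doubled_peak f}. ?g f)"
    unfolding Suc by (rule sum.inter_filter[symmetric]) simp
  also have "\<dots> = (\<Sum>p\<in>{p \<in> avoiders_of_length k m. peaked p}. ?g (hd p # p))"
    by (rule sum.reindex_bij_betw[OF bij_doubled_peak, symmetric])
  also have "\<dots> = (\<Sum>p\<in>{p \<in> avoiders_of_length k m. peaked p}.
      (1 - z) * weight y z k (\<lambda>\<tau>. h (Suc \<tau>)) p)"
  proof (rule sum.cong[OF refl])
    fix p assume "p \<in> {p \<in> avoiders_of_length k m. peaked p}"
    then obtain a s where p: "p = a # s" "\<forall>b\<in>set s. b < a" and "a # s \<in> avoiders k"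
      by (auto simp: peaked_def avoiders_of_length_def)
    then have "a < k" by (simp add: avoiders_def)
    have "card (cuts (a # a # s)) = Suc (card (cuts (a # s)))"
    proof -
      have "1 \<notin> Suc ` cuts (a # s)" by auto
      then show ?thesis unfolding doubled_peak_cuts[OF p(2)] by (simp add: card_image)
    qed
    moreover have "shifted_rank k (a # s) = k - 1 - a" for k using p(2) by (cases s) auto
    then have "shifted_rank k (a # a # s) = Suc (shifted_rank k (a # s))" using \<open>a < k\<close> by simp
    ultimately show "?g (hd p # p) = (1 - z) * weight y z k (\<lambda>\<tau>. h (Suc \<tau>)) p"
      unfolding p weight_def by (simp add: algebra_simps)
  qed
  also have "\<dots> = (1 - z) * weight_sum peaked y z k m (\<lambda>\<tau>. h (Suc \<tau>))"
    unfolding weight_sum_def sum_distrib_left[symmetric]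
    by (subst sum.inter_filter) simp_all
  finally show ?thesis by (simp add: Suc)
qed

text \<open>The empty list is split off because its default rank changes with \<open>k\<close>,
  against the invariance that nonempty lists enjoy. It reappears in the explicit terms
  \<open>z ^ k * h 1\<close> and \<open>z ^ Suc k * h 2\<close>, which belong to the lists
  \<open>[0]\<close> and \<open>[0, 0]\<close>.\<close>

lemma weight_sum_nonempty_Suc:
  "weight_sum (\<lambda>e. e \<noteq> []) y z (Suc k) n h =
    weight_sum (\<lambda>e. e \<noteq> []) y z k n h +
    (if 1 \<le> n then y *
       (weight_sum (\<lambda>e. e \<noteq> []) y z k (n - 1) (insertions1 h) +
        (if 1 \<le> n - 1 then (1 - z) * weight_sum peaked y z k (n - 1 - 1) (\<lambda>_. h 2) else 0) +
        weight_sum (\<lambda>e. e \<noteq> []) y z (Suc k) (n - 1) (\<lambda>_. h 1) +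
        (if n - 1 = 0 then z ^ k * h 1 else 0)) else 0) +
    (if 2 \<le> n then y *
       (weight_sum (\<lambda>e. e \<noteq> []) y z k (n - 2) (insertions2 h) +
        (if 1 \<le> n - 2 then (1 - z) *
           weight_sum peaked y z k (n - 2 - 1) (\<lambda>\<tau>. of_nat \<tau> * h 2 + h 3) else 0) +
        weight_sum (\<lambda>e. e \<noteq> []) y z (Suc k) (n - 2) (\<lambda>\<tau>. of_nat (\<tau> - 1) * h 1 + h 2) +
        (if 1 \<le> n - 2 then (1 - z) * weight_sum peaked y z (Suc k) (n - 2 - 1) (\<lambda>_. h 1) else 0) +
        weight_sum (\<lambda>e. e \<noteq> []) y z (Suc (Suc k)) (n - 2) (\<lambda>_. h 1) +
        (if n - 2 = 0 then z ^ Suc k * h 2 else 0)) else 0)"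
proof -
  let ?\<Omega> = "\<lambda>e. if e \<noteq> [] then weight y z (Suc k) h e else 0"
  let ?N = "\<lambda>e::nat list. e \<noteq> []"
  let ?dp = "\<lambda>k f h. if doubled_peak f then y ^ card (set f) *
      (z ^ (shifted_rank k f - 1) - z ^ shifted_rank k f) * h (card (cuts f)) else 0"
  have *: "f \<in> avoiders k'" if "f \<in> avoiders_of_length k' n'" for f k' n'
    using that by (simp add: avoiders_of_length_def)
  have 0: "(\<Sum>f\<in>avoiders_of_length k n. ?\<Omega> (map Suc f)) = weight_sum ?N y z k n h"
    unfolding weight_sum_def by (rule sum.cong) (auto simp: weight_map_Suc)
  have 1: "(\<Sum>f\<in>avoiders_of_length k m. \<Sum>q\<in>cuts f. ?\<Omega> (insert_zero q f)) =
      y * (weight_sum ?N y z k m (insertions1 h) +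
        (if 1 \<le> m then (1 - z) * weight_sum peaked y z k (m - 1) (\<lambda>_. h 2) else 0))" for m
  proof -
    have "(\<Sum>f\<in>avoiders_of_length k m. \<Sum>q\<in>cuts f. ?\<Omega> (insert_zero q f)) =
        (\<Sum>f\<in>avoiders_of_length k m. y * ((if f \<noteq> [] then weight y z k (insertions1 h) f else 0) +
           ?dp k f (\<lambda>_. h 2)))"
    proof (rule sum.cong[OF refl])
      fix f assume "f \<in> avoiders_of_length k m"
      then have "(\<Sum>q\<in>cuts f. weight y z (Suc k) h (insert_zero q f)) =
          y * (weight y z k (insertions1 h) f + ?dp k f (\<lambda>_. h 2))"
        by (intro weight_insert_zero *)
      moreover have "weight y z k (insertions1 h) [] = 0" by (simp add: weight_def insertions1_def)
      moreover have "?\<Omega> (insert_zero q f) = weight y z (Suc k) h (insert_zero q f)" for q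
        by (simp add: insert_zero_def)
      ultimately show "(\<Sum>q\<in>cuts f. ?\<Omega> (insert_zero q f)) =
         y * ((if f \<noteq> [] then weight y z k (insertions1 h) f else 0) + ?dp k f (\<lambda>_. h 2))"
        by auto
    qed
    then show ?thesis
      unfolding sum_distrib_left[symmetric] sum.distrib
        sum_doubled_peak[where h = "\<lambda>_. h 2"] weight_sum_def by simp
  qed
  have 2: "(\<Sum>f\<in>avoiders_of_length (Suc k) m. ?\<Omega> (0 # map Suc f)) =
      y * (weight_sum ?N y z (Suc k) m (\<lambda>_. h 1) + (if m = 0 then z ^ k * h 1 else 0))" for m
  proof (cases m)
    case 0
    have "weight y z (Suc k) h [0] = y * (z ^ k * h 1)"
      using weight_zero_map_Suc[of y z k h "[]"] by (simp add: weight_def mult.assoc)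
    then show ?thesis using 0 by (simp add: weight_sum_def)
  next
    case (Suc m')
    then have "f \<noteq> []" if "f \<in> avoiders_of_length (Suc k) m" for f
      using that by (auto simp: avoiders_of_length_def)
    then show ?thesis using Suc
      by (auto simp: weight_zero_map_Suc weight_sum_def sum_distrib_left intro!: sum.cong)
  qed
  have 3: "(\<Sum>f\<in>avoiders_of_length k m. \<Sum>q\<in>cuts f. \<Sum>r\<in>{r \<in> cuts f. q \<le> r}. ?\<Omega> (insert_zeros q r f)) =
      y * (weight_sum ?N y z k m (insertions2 h) +
        (if 1 \<le> m then (1 - z) * weight_sum peaked y z k (m - 1) (\<lambda>\<tau>. of_nat \<tau> * h 2 + h 3) else 0))" for m
  proof -
    have "(\<Sum>f\<in>avoiders_of_length k m. \<Sum>q\<in>cuts f. \<Sum>r\<in>{r \<in> cuts f. q \<le> r}. ?\<Omega> (insert_zeros q r f)) =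
        (\<Sum>f\<in>avoiders_of_length k m. y * ((if f \<noteq> [] then weight y z k (insertions2 h) f else 0) +
           ?dp k f (\<lambda>\<tau>. of_nat (\<tau> - 1) * h 2 + h 3)))"
    proof (rule sum.cong[OF refl])
      fix f assume "f \<in> avoiders_of_length k m"
      then have "(\<Sum>q\<in>cuts f. \<Sum>r\<in>{r \<in> cuts f. q \<le> r}. weight y z (Suc k) h (insert_zeros q r f)) =
          y * (weight y z k (insertions2 h) f + ?dp k f (\<lambda>\<tau>. of_nat (\<tau> - 1) * h 2 + h 3))"
        by (intro weight_insert_zeros *)
      moreover have "weight y z k (insertions2 h) [] = 0" by (simp add: weight_def insertions2_def)
      moreover have "?\<Omega> (insert_zeros q r f) = weight y z (Suc k) h (insert_zeros q r f)" for q r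
        by (simp add: insert_zeros_def)
      ultimately show "(\<Sum>q\<in>cuts f. \<Sum>r\<in>{r \<in> cuts f. q \<le> r}. ?\<Omega> (insert_zeros q r f)) =
         y * ((if f \<noteq> [] then weight y z k (insertions2 h) f else 0) +
           ?dp k f (\<lambda>\<tau>. of_nat (\<tau> - 1) * h 2 + h 3))"
        by auto
    qed
    then show ?thesis
      unfolding sum_distrib_left[symmetric] sum.distrib
        sum_doubled_peak[where h = "\<lambda>\<tau>. of_nat (\<tau> - 1) * h 2 + h 3"] weight_sum_def by (simp only: diff_Suc_1)
  qed
  have 4: "(\<Sum>f\<in>avoiders_of_length (Suc k) m. \<Sum>r\<in>cuts f. ?\<Omega> (0 # insert_zero r f)) =
      y * (weight_sum ?N y z (Suc k) m (\<lambda>\<tau>. of_nat (\<tau> - 1) * h 1 + h 2) +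
        (if 1 \<le> m then (1 - z) * weight_sum peaked y z (Suc k) (m - 1) (\<lambda>_. h 1) else 0))" for m
  proof -
    have "(\<Sum>f\<in>avoiders_of_length (Suc k) m. \<Sum>r\<in>cuts f. ?\<Omega> (0 # insert_zero r f)) =
        (\<Sum>f\<in>avoiders_of_length (Suc k) m. y * ((if f \<noteq> [] then
             weight y z (Suc k) (\<lambda>\<tau>. of_nat (\<tau> - 1) * h 1 + h 2) f else 0) +
           ?dp (Suc k) f (\<lambda>_. h 1)))"
      by (rule sum.cong[OF refl]) (simp add: weight_zero_insert_zero[OF *])
    then show ?thesis
      unfolding sum_distrib_left[symmetric] sum.distrib
        sum_doubled_peak[where h = "\<lambda>_. h 1"] weight_sum_def by simp
  qed
  have 5: "(\<Sum>f\<in>avoiders_of_length (Suc (Suc k)) m. ?\<Omega> (0 # 0 # map Suc f)) =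
      y * (weight_sum ?N y z (Suc (Suc k)) m (\<lambda>_. h 1) + (if m = 0 then z ^ Suc k * h 2 else 0))" for m
  proof (cases m)
    case 0
    have "weight y z (Suc k) h [0, 0] = y * (z ^ Suc k * h 2)"
      using weight_zero_zero_map_Suc[of y z k h "[]"] by (simp add: weight_def mult.assoc)
    then show ?thesis using 0 by (simp add: weight_sum_def)
  next
    case (Suc m')
    then have "f \<noteq> []" if "f \<in> avoiders_of_length (Suc (Suc k)) m" for f
      using that by (auto simp: avoiders_of_length_def)
    then show ?thesis using Suc
      by (auto simp: weight_zero_zero_map_Suc weight_sum_def sum_distrib_left intro!: sum.cong)
  qed
  have "weight_sum ?N y z (Suc k) n h = (\<Sum>e\<in>avoiders_of_length (Suc k) n. ?\<Omega> e)"
    by (simp add: weight_sum_def)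
  then show ?thesis unfolding sum_avoiders_Suc[of ?\<Omega> k n] 0 1 2 3 4 5
    by (simp only: distrib_left add.assoc)
qed

text \<open>The only peaked list with a leading zero is \<open>[0]\<close>, so no sum of level
  \<open>k + 1\<close> or above enters; and a peaked list is never a doubled peak, so no rank
  correction arises.\<close>

lemma weight_sum_peaked_Suc:
  "weight_sum peaked y z (Suc k) n h =
    weight_sum peaked y z k n h +
    (if 1 \<le> n then y * (weight_sum peaked y z k (n - 1) (insertions1 h) +
        (if n - 1 = 0 then z ^ k * h 1 else 0)) else 0) +
    (if 2 \<le> n then y * weight_sum peaked y z k (n - 2) (insertions2 h) else 0)"
proof -
  let ?\<Omega> = "\<lambda>e. if peaked e then weight y z (Suc k) h e else 0"
  have *: "f \<in> avoiders k'" if "f \<in> avoiders_of_length k' n'" for f k' n'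
    using that by (simp add: avoiders_of_length_def)
  have ndp: "\<not> doubled_peak f" if "peaked f" for f
    using that by (auto simp: peaked_def doubled_peak_def)
  have 0: "(\<Sum>f\<in>avoiders_of_length k n. ?\<Omega> (map Suc f)) = weight_sum peaked y z k n h"
  proof -
    have "f \<noteq> []" if "peaked f" for f using that by (auto simp: peaked_def)
    then show ?thesis
      unfolding weight_sum_def by (intro sum.cong refl) (metis weight_map_Suc peaked_map_Suc)
  qed
  have 1: "(\<Sum>f\<in>avoiders_of_length k m. \<Sum>q\<in>cuts f. ?\<Omega> (insert_zero q f)) =
      y * weight_sum peaked y z k m (insertions1 h)" for m
    unfolding weight_sum_def sum_distrib_left
  proof (rule sum.cong[OF refl])
    fix f assume "f \<in> avoiders_of_length k m"
    then show "(\<Sum>q\<in>cuts f. ?\<Omega> (insert_zero q f)) =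
        y * (if peaked f then weight y z k (insertions1 h) f else 0)"
      using weight_insert_zero[OF *, of f k m y z h] ndp[of f] by (simp add: peaked_insert_zero)
  qed
  have 2: "(\<Sum>f\<in>avoiders_of_length (Suc k) m. ?\<Omega> (0 # map Suc f)) =
      y * (if m = 0 then z ^ k * h 1 else 0)" for m
  proof (cases m)
    case 0
    have "weight y z (Suc k) h [0] = y * (z ^ k * h 1)"
      using weight_zero_map_Suc[of y z k h "[]"] by (simp add: weight_def mult.assoc)
    then show ?thesis using 0 by simp
  next
    case (Suc m')
    then have "f \<noteq> []" if "f \<in> avoiders_of_length (Suc k) m" for f
      using that by (auto simp: avoiders_of_length_def)
    then show ?thesis using Suc by simp
  qed
  have 3: "(\<Sum>f\<in>avoiders_of_length k m. \<Sum>q\<in>cuts f. \<Sum>r\<in>{r \<in> cuts f. q \<le> r}. ?\<Omega> (insert_zeros q r f)) =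
      y * weight_sum peaked y z k m (insertions2 h)" for m
    unfolding weight_sum_def sum_distrib_left
  proof (rule sum.cong[OF refl])
    fix f assume "f \<in> avoiders_of_length k m"
    then show "(\<Sum>q\<in>cuts f. \<Sum>r\<in>{r \<in> cuts f. q \<le> r}. ?\<Omega> (insert_zeros q r f)) =
        y * (if peaked f then weight y z k (insertions2 h) f else 0)"
      using weight_insert_zeros[OF *, of f k m y z h] ndp[of f] by (simp add: peaked_insert_zeros)
  qed
  have 4: "(\<Sum>f\<in>avoiders_of_length (Suc k) m. \<Sum>r\<in>cuts f. ?\<Omega> (0 # insert_zero r f)) = 0" for m
    by (simp add: insert_zero_def)
  have 5: "(\<Sum>f\<in>avoiders_of_length (Suc (Suc k)) m. ?\<Omega> (0 # 0 # map Suc f)) = 0" for m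
    by simp
  have "weight_sum peaked y z (Suc k) n h = (\<Sum>e\<in>avoiders_of_length (Suc k) n. ?\<Omega> e)"
    by (simp add: weight_sum_def)
  then show ?thesis unfolding sum_avoiders_Suc[of ?\<Omega> k n] 0 1 2 3 4 5
    by (simp only: distrib_left add_0_right)
qed

text \<open>At level 0 the bound leaves no room for a first entry. This is the initial condition for
  the telescoping in \<open>k\<close>.\<close>

lemma weight_sum_0: "\<not> Q [] \<Longrightarrow> weight_sum Q y z 0 n h = 0"
proof -
  have "e = []" if "e \<in> avoiders_of_length 0 n" for e
    using that by (cases e) (auto simp: avoiders_of_length_def avoiders_def)
  then show "\<not> Q [] \<Longrightarrow> weight_sum Q y z 0 n h = 0"
    unfolding weight_sum_def by (intro sum.neutral) auto
qed

section \<open>Generating functions\<close>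

lemma fps_X_power_dvd_iff:
  fixes f :: "'a::comm_ring_1 fps"
  shows "fps_X ^ n dvd f \<longleftrightarrow> (\<forall>i<n. fps_nth f i = 0)"
proof
  assume "fps_X ^ n dvd f"
  then show "\<forall>i<n. fps_nth f i = 0" by (auto simp: fps_X_power_mult_nth elim!: dvdE)
next
  assume *: "\<forall>i<n. fps_nth f i = 0"
  have "f = fps_X ^ n * fps_shift n f"
    by (rule fps_ext) (use * in \<open>auto simp: fps_X_power_mult_nth\<close>)
  then show "fps_X ^ n dvd f" by (metis dvd_triv_left)
qed

text \<open>The hypothesis is a Lipschitz condition for the X-adic metric; the factor
  \<open>fps_X\<close> turns it into a contraction, and \<open>d\<close> is the limit of the
  iterates of 0.\<close>

lemma fps_fixed_point_exists:
  fixes \<Psi> :: "'a::comm_ring_1 fps \<Rightarrow> 'a fps"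
  assumes lip: "\<And>f g. f - g dvd \<Psi> f - \<Psi> g"
  shows "\<exists>d. d = fps_X * \<Psi> d"
proof -
  define s where "s n = ((\<lambda>f. fps_X * \<Psi> f) ^^ n) 0" for n
  have s_Suc: "s (Suc n) = fps_X * \<Psi> (s n)" for n by (simp add: s_def)
  have contract: "fps_X ^ Suc n dvd fps_X * \<Psi> f - fps_X * \<Psi> g" if "fps_X ^ n dvd f - g" for n f g
    using mult_dvd_mono[OF dvd_refl[of fps_X] dvd_trans[OF that lip]] by (simp add: algebra_simps)
  have "fps_X ^ n dvd s (Suc n) - s n" for n
  proof (induction n)
    case (Suc n)
    then show ?case unfolding s_Suc[of "Suc n"] by (subst (2) s_Suc) (rule contract)
  qed simp
  then have step: "fps_nth (s (Suc n)) i = fps_nth (s n) i" if "i < n" for i n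
    using that unfolding fps_X_power_dvd_iff by auto
  \<comment> \<open>The i-th coefficient no longer changes from iterate \<open>i + 1\<close> on, so
    the diagonal defines the limit.\<close>
  have stable: "fps_nth (s n) i = fps_nth (s (Suc i)) i" if "i < n" for i n
    using that
  proof (induction n)
    case (Suc n)
    then show ?case using step[of i n] by (cases "i = n") auto
  qed simp
  define d where "d = Abs_fps (\<lambda>i. fps_nth (s (Suc i)) i)"
  have near: "fps_X ^ n dvd d - s n" for n
    unfolding fps_X_power_dvd_iff by (simp add: d_def stable[of _ n])
  have "fps_nth d i = fps_nth (fps_X * \<Psi> d) i" for i
  proof -
    have "fps_X ^ Suc i dvd d - s (Suc (Suc i))"
      using near[of "Suc (Suc i)"] unfolding fps_X_power_dvd_iff by simp
    moreover have "fps_X ^ Suc i dvd fps_X * \<Psi> d - s (Suc (Suc i))"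
      using contract[OF near[of "Suc i"]] unfolding s_Suc[of "Suc i"] fps_X_power_dvd_iff by simp
    ultimately show ?thesis unfolding fps_X_power_dvd_iff by auto
  qed
  then show ?thesis using fps_ext by blast
qed

lemma dvd_diff_mult: "d dvd a - a' \<Longrightarrow> d dvd b - b' \<Longrightarrow> d dvd a * b - a' * b'"
  for d :: "'a::comm_ring_1"
proof -
  assume "d dvd a - a'" "d dvd b - b'"
  then have "d dvd (a - a') * b + a' * (b - b')" by simp
  then show ?thesis by (simp add: algebra_simps)
qed

lemma dvd_diff_add: "d dvd a - a' \<Longrightarrow> d dvd b - b' \<Longrightarrow> d dvd (a + b) - (a' + b')"
  for d :: "'a::comm_ring_1"
proof -
  assume "d dvd a - a'" "d dvd b - b'"
  then have "d dvd (a - a') + (b - b')" by (rule dvd_add)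
  then show ?thesis by (simp add: algebra_simps)
qed

lemma kernel_root_exists:
  fixes y :: "'a::comm_ring_1 fps"
  shows "\<exists>d. d = fps_X * (y * (1 + d)\<^sup>2 * (d + fps_X * (1 + d + d\<^sup>2)))"
  by (rule fps_fixed_point_exists)
    (unfold power2_eq_square, intro dvd_diff_mult dvd_diff_add dvd_refl; simp)

text \<open>The infinite sum of \<open>fps_X ^ n * g n\<close>, written by coefficients. The
  \<open>g n\<close> are themselves series in x, because the catalytic variable gets the value
  \<open>1 + d\<close>.\<close>

definition length_series :: "(nat \<Rightarrow> 'a::comm_ring_1 fps) \<Rightarrow> 'a fps" where
  "length_series g = Abs_fps (\<lambda>j. \<Sum>n\<le>j. fps_nth (g n) (j - n))"

lemma length_series_nth:
  "j \<le> M \<Longrightarrow> fps_nth (length_series g) j = fps_nth (\<Sum>n\<le>M. fps_X ^ n * g n) j"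
proof -
  assume "j \<le> M"
  then have "(\<Sum>n\<le>M. if j < n then 0 else fps_nth (g n) (j - n)) = (\<Sum>n\<le>j. fps_nth (g n) (j - n))"
    by (intro sum.mono_neutral_cong_right) auto
  then show ?thesis by (simp add: length_series_def fps_sum_nth fps_X_power_mult_nth)
qed

lemma length_series_add: "length_series (\<lambda>n. f n + g n) = length_series f + length_series g"
  by (rule fps_ext) (simp add: length_series_def sum.distrib)

text \<open>As \<open>c\<close> may involve x, the coefficients mix; the claim is reduced to a
  finite truncation, where it is distributivity.\<close>

lemma length_series_cmult: "length_series (\<lambda>n. c * g n) = c * length_series g"
proof (rule fps_ext)
  fix j
  have "fps_nth (c * length_series g) j = (\<Sum>i=0..j. fps_nth c i * fps_nth (\<Sum>n\<le>j. fps_X ^ n * g n) (j - i))"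
    unfolding fps_mult_nth by (intro sum.cong refl) (subst length_series_nth[of _ j], auto)
  also have "\<dots> = fps_nth (c * (\<Sum>n\<le>j. fps_X ^ n * g n)) j" by (simp add: fps_mult_nth)
  also have "c * (\<Sum>n\<le>j. fps_X ^ n * g n) = (\<Sum>n\<le>j. fps_X ^ n * (c * g n))"
    by (simp add: sum_distrib_left mult.left_commute)
  finally show "fps_nth (length_series (\<lambda>n. c * g n)) j = fps_nth (c * length_series g) j"
    by (simp only: length_series_nth[OF order_refl])
qed

lemma length_series_shift:
  "length_series (\<lambda>n. if 1 \<le> n then g (n - 1) else 0) = fps_X * length_series g"
proof (rule fps_ext)
  fix j
  show "fps_nth (length_series (\<lambda>n. if 1 \<le> n then g (n - 1) else 0)) j =
      fps_nth (fps_X * length_series g) j"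
    by (cases j) (simp_all add: length_series_def sum.atMost_Suc_shift del: sum.atMost_Suc)
qed

lemma length_series_shift2:
  "length_series (\<lambda>n. if 2 \<le> n then g (n - 2) else 0) = fps_X\<^sup>2 * length_series g"
proof -
  have "(\<lambda>n. if 2 \<le> n then g (n - 2) else 0) =
      (\<lambda>n. if 1 \<le> n then (\<lambda>n. if 1 \<le> n then g (n - 1) else 0) (n - 1) else 0)"
    by (auto simp: fun_eq_iff numeral_2_eq_2)
  then show ?thesis
    by (simp only: length_series_shift[of "\<lambda>n. if 1 \<le> n then g (n - 1) else 0"] length_series_shift
        power2_eq_square mult.assoc)
qed

lemma length_series_single: "length_series (\<lambda>n. if n = 0 then a else 0) = a"
  by (rule fps_ext) (simp add: length_series_def if_distrib[of "\<lambda>f. fps_nth f _"] cong: if_cong)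

definition weight_series ::
    "(nat list \<Rightarrow> bool) \<Rightarrow> 'a::comm_ring_1 fps \<Rightarrow> 'a fps \<Rightarrow> nat \<Rightarrow> (nat \<Rightarrow> 'a fps) \<Rightarrow> 'a fps" where
  "weight_series Q y z k h = length_series (\<lambda>n. weight_sum Q y z k n h)"

section \<open>Linearity in the cut weight and the recurrences for series\<close>

lemma weight_sum_add:
  "weight_sum Q y z k n (\<lambda>\<tau>. g \<tau> + h \<tau>) = weight_sum Q y z k n g + weight_sum Q y z k n h"
  unfolding weight_sum_def sum.distrib[symmetric]
  by (rule sum.cong) (auto simp: weight_def algebra_simps)

lemma weight_sum_cmult:
  "weight_sum Q y z k n (\<lambda>\<tau>. c * h \<tau>) = c * weight_sum Q y z k n h"
  unfolding weight_sum_def sum_distrib_left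
  by (rule sum.cong) (auto simp: weight_def algebra_simps)

lemma weight_series_add:
  "weight_series Q y z k (\<lambda>\<tau>. g \<tau> + h \<tau>) = weight_series Q y z k g + weight_series Q y z k h"
  by (simp add: weight_series_def weight_sum_add length_series_add)

lemma weight_series_cmult:
  "weight_series Q y z k (\<lambda>\<tau>. c * h \<tau>) = c * weight_series Q y z k h"
  by (simp add: weight_series_def weight_sum_cmult length_series_cmult)

lemma weight_series_const:
  "weight_series Q y z k (\<lambda>\<tau>. c) = c * weight_series Q y z k (\<lambda>\<tau>. 1)"
  using weight_series_cmult[of Q y z k c "\<lambda>\<tau>. 1"] by simp

text \<open>The end of a nonempty list is a cut, so the weight is never evaluated at 0. This turns
  the truncated \<open>\<tau> - 1\<close> into ring subtraction.\<close>

lemma weight_series_cong: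
  assumes "\<not> Q []" "\<And>\<tau>. 1 \<le> \<tau> \<Longrightarrow> g \<tau> = h \<tau>"
  shows "weight_series Q y z k g = weight_series Q y z k h"
proof -
  have "1 \<le> card (cuts e)" if "Q e" for e
    using length_in_cuts[of e] that assms(1) by (metis One_nat_def Suc_le_eq card_gt_0_iff empty_iff finite_cuts)
  then show ?thesis
    unfolding weight_series_def weight_sum_def
    by (intro arg_cong[where f = length_series] ext sum.cong) (auto simp: weight_def assms(2))
qed

lemma weight_series_0: "\<not> Q [] \<Longrightarrow> weight_series Q y z 0 h = 0"
  by (simp add: weight_series_def weight_sum_0 length_series_def fps_eq_iff)

lemma weight_series_nonempty_Suc:
  "weight_series (\<lambda>e. e \<noteq> []) y z (Suc k) h =
    weight_series (\<lambda>e. e \<noteq> []) y z k h +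
    fps_X * (y *
       (weight_series (\<lambda>e. e \<noteq> []) y z k (insertions1 h) +
        fps_X * ((1 - z) * weight_series peaked y z k (\<lambda>_. h 2)) +
        weight_series (\<lambda>e. e \<noteq> []) y z (Suc k) (\<lambda>_. h 1) + z ^ k * h 1)) +
    fps_X\<^sup>2 * (y *
       (weight_series (\<lambda>e. e \<noteq> []) y z k (insertions2 h) +
        fps_X * ((1 - z) * weight_series peaked y z k (\<lambda>\<tau>. of_nat \<tau> * h 2 + h 3)) +
        weight_series (\<lambda>e. e \<noteq> []) y z (Suc k) (\<lambda>\<tau>. of_nat (\<tau> - 1) * h 1 + h 2) +
        fps_X * ((1 - z) * weight_series peaked y z (Suc k) (\<lambda>_. h 1)) +
        weight_series (\<lambda>e. e \<noteq> []) y z (Suc (Suc k)) (\<lambda>_. h 1) + z ^ Suc k * h 2))"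
proof -
  let ?N = "\<lambda>e::nat list. e \<noteq> []"
  define A where "A n = weight_sum ?N y z k n (insertions1 h) +
        (if 1 \<le> n then (1 - z) * weight_sum peaked y z k (n - 1) (\<lambda>_. h 2) else 0) +
        weight_sum ?N y z (Suc k) n (\<lambda>_. h 1) +
        (if n = 0 then z ^ k * h 1 else 0)" for n
  define B where "B n = weight_sum ?N y z k n (insertions2 h) +
        (if 1 \<le> n then (1 - z) * weight_sum peaked y z k (n - 1) (\<lambda>\<tau>. of_nat \<tau> * h 2 + h 3) else 0) +
        weight_sum ?N y z (Suc k) n (\<lambda>\<tau>. of_nat (\<tau> - 1) * h 1 + h 2) +
        (if 1 \<le> n then (1 - z) * weight_sum peaked y z (Suc k) (n - 1) (\<lambda>_. h 1) else 0) +
        weight_sum ?N y z (Suc (Suc k)) n (\<lambda>_. h 1) +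
        (if n = 0 then z ^ Suc k * h 2 else 0)" for n
  have "weight_sum ?N y z (Suc k) n h = weight_sum ?N y z k n h +
      (if 1 \<le> n then (\<lambda>n. y * A n) (n - 1) else 0) + (if 2 \<le> n then (\<lambda>n. y * B n) (n - 2) else 0)" for n
    unfolding A_def B_def by (rule weight_sum_nonempty_Suc)
  then have "weight_series ?N y z (Suc k) h = weight_series ?N y z k h +
      fps_X * (y * length_series A) + fps_X\<^sup>2 * (y * length_series B)"
    unfolding weight_series_def
    by (simp only: length_series_add length_series_shift[of "\<lambda>n. y * A n"]
        length_series_shift2[of "\<lambda>n. y * B n"] length_series_cmult)
  also have "length_series A = weight_series ?N y z k (insertions1 h) +
        fps_X * ((1 - z) * weight_series peaked y z k (\<lambda>_. h 2)) +
        weight_series ?N y z (Suc k) (\<lambda>_. h 1) + z ^ k * h 1"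
    unfolding A_def weight_series_def
    by (simp only: length_series_add
        length_series_shift[of "\<lambda>n. (1 - z) * weight_sum peaked y z k n (\<lambda>_. h 2)"]
        length_series_cmult length_series_single)
  also have "length_series B = weight_series ?N y z k (insertions2 h) +
        fps_X * ((1 - z) * weight_series peaked y z k (\<lambda>\<tau>. of_nat \<tau> * h 2 + h 3)) +
        weight_series ?N y z (Suc k) (\<lambda>\<tau>. of_nat (\<tau> - 1) * h 1 + h 2) +
        fps_X * ((1 - z) * weight_series peaked y z (Suc k) (\<lambda>_. h 1)) +
        weight_series ?N y z (Suc (Suc k)) (\<lambda>_. h 1) + z ^ Suc k * h 2"
    unfolding B_def weight_series_def
    by (simp only: length_series_add
        length_series_shift[of "\<lambda>n. (1 - z) * weight_sum peaked y z k n (\<lambda>\<tau>. of_nat \<tau> * h 2 + h 3)"]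
        length_series_shift[of "\<lambda>n. (1 - z) * weight_sum peaked y z (Suc k) n (\<lambda>_. h 1)"]
        length_series_cmult length_series_single)
  finally show ?thesis .
qed

lemma weight_series_peaked_Suc:
  "weight_series peaked y z (Suc k) h =
    weight_series peaked y z k h +
    fps_X * (y * (weight_series peaked y z k (insertions1 h) + z ^ k * h 1)) +
    fps_X\<^sup>2 * (y * weight_series peaked y z k (insertions2 h))"
proof -
  define A where "A n = weight_sum peaked y z k n (insertions1 h) +
        (if n = 0 then z ^ k * h 1 else 0)" for n
  have "weight_sum peaked y z (Suc k) n h = weight_sum peaked y z k n h +
      (if 1 \<le> n then (\<lambda>n. y * A n) (n - 1) else 0) +
      (if 2 \<le> n then (\<lambda>n. y * weight_sum peaked y z k n (insertions2 h)) (n - 2) else 0)" for n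
    unfolding A_def by (rule weight_sum_peaked_Suc)
  then have "weight_series peaked y z (Suc k) h = weight_series peaked y z k h +
      fps_X * (y * length_series A) + fps_X\<^sup>2 * (y * weight_series peaked y z k (insertions2 h))"
    unfolding weight_series_def
    by (simp only: length_series_add length_series_shift[of "\<lambda>n. y * A n"]
        length_series_shift2[of "\<lambda>n. y * weight_sum peaked y z k n (insertions2 h)"]
        length_series_cmult)
  also have "length_series A = weight_series peaked y z k (insertions1 h) + z ^ k * h 1"
    unfolding A_def weight_series_def
    by (simp only: length_series_add length_series_cmult length_series_single)
  finally show ?thesis .
qed

text \<open>For any \<open>u = 1 + d\<close> with \<open>d\<close> invertible, geometric summation
  gives \<open>(d + c) * u ^ \<tau> - c - x\<^sup>2 * y * u\<^sup>2 * of_nat \<tau>\<close> with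
  \<open>c = x * y * u\<^sup>2 * (d + x * (1 + d + d\<^sup>2)) / d\<close>. The hypothesis says
  \<open>c = 1\<close>; induction on \<open>\<tau>\<close> avoids the division.\<close>

lemma kernel_identity:
  fixes d x y :: "'a::comm_ring_1"
  assumes d: "d = x * (y * (1 + d)\<^sup>2 * (d + x * (1 + d + d\<^sup>2)))"
  defines "u \<equiv> 1 + d"
  shows "d * (u ^ \<tau> + x * y * insertions1 (\<lambda>\<tau>. u ^ \<tau>) \<tau> + x\<^sup>2 * y * insertions2 (\<lambda>\<tau>. u ^ \<tau>) \<tau>) =
    u * u ^ \<tau> - 1 - x\<^sup>2 * y * u\<^sup>2 * of_nat \<tau>"
proof (induction \<tau>)
  case 0
  show ?case by (simp add: insertions1_def insertions2_def u_def)
next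
  case (Suc \<tau>)
  let ?i1 = "insertions1 (\<lambda>\<tau>. u ^ \<tau>)" and ?i2 = "insertions2 (\<lambda>\<tau>. u ^ \<tau>)"
  have 1: "?i1 (Suc \<tau>) = ?i1 \<tau> + u ^ Suc (Suc \<tau>)" by (simp add: insertions1_def)
  have "(\<Sum>i=1..\<tau>. of_nat (Suc \<tau> - i) * u ^ Suc i + u ^ Suc (Suc i)) =
      (\<Sum>i=1..\<tau>. (of_nat (\<tau> - i) * u ^ Suc i + u ^ Suc (Suc i)) + u ^ Suc i)"
    by (intro sum.cong) (auto simp: Suc_diff_le algebra_simps)
  \<comment> \<open>One more cut offers every earlier choice of the first zero one more place for
    the second, which adds a copy of \<open>insertions1\<close>.\<close>
  then have 2: "?i2 (Suc \<tau>) = ?i2 \<tau> + ?i1 \<tau> + u ^ Suc (Suc (Suc \<tau>))"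
    by (simp add: insertions2_def insertions1_def sum.distrib)
  have 3: "d * ?i1 \<tau> = u ^ Suc (Suc \<tau>) - u\<^sup>2"
  proof (induction \<tau>)
    case (Suc \<tau>)
    then show ?case by (simp add: insertions1_def u_def algebra_simps)
  qed (simp add: insertions1_def power2_eq_square)
  have "d * (u ^ Suc \<tau> + x * y * ?i1 (Suc \<tau>) + x\<^sup>2 * y * ?i2 (Suc \<tau>)) =
      d * (u ^ \<tau> + x * y * ?i1 \<tau> + x\<^sup>2 * y * ?i2 \<tau>) + d * (u ^ Suc \<tau> - u ^ \<tau>) +
      x\<^sup>2 * y * (d * ?i1 \<tau>) + u ^ \<tau> * (x * y * u\<^sup>2 * d + x\<^sup>2 * y * u ^ 3 * d)"
    unfolding 1 2 by (simp add: algebra_simps power2_eq_square power3_eq_cube)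
  also have "\<dots> = u * u ^ \<tau> - 1 - x\<^sup>2 * y * u\<^sup>2 * of_nat (Suc \<tau>) + d * (u ^ Suc \<tau> - u ^ \<tau>) +
      u ^ \<tau> * (x * (y * u\<^sup>2 * (d + x * (1 + d * u))))"
    unfolding Suc.IH 3 by (simp add: algebra_simps power2_eq_square power3_eq_cube)
  \<comment> \<open>The kernel equation enters here, with
    \<open>1 + d * u = 1 + d + d\<^sup>2\<close>.\<close>
  also have "x * (y * u\<^sup>2 * (d + x * (1 + d * u))) = d"
    using d by (simp add: u_def algebra_simps power2_eq_square)
  finally show ?case by (simp add: u_def algebra_simps)
qed

text \<open>The kernel equation makes all unknown series at level \<open>k + 1\<close> collapse into the same
  combination as at level \<open>k\<close>.\<close>

lemma kernel_step:
  fixes d x y z :: "'a::comm_ring_1" and a :: 'a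
  assumes d: "d = x * (y * (1 + d)\<^sup>2 * (d + x * (1 + d + d\<^sup>2)))"
  defines "u \<equiv> 1 + d"
  assumes G: "d * G' = (u * G - G1 - x\<^sup>2 * y * u\<^sup>2 * Gd) +
      d * (x * (y * (x * ((1 - z) * (u\<^sup>2 * P1)) + u * G1' + a * u)) +
        x\<^sup>2 * (y * (x * ((1 - z) * (u\<^sup>2 * Pd + u ^ 3 * P1)) + (u * Gd' - u * G1' + u\<^sup>2 * G1') +
          x * ((1 - z) * (u * P1')) + u * G1'' + a * z * u\<^sup>2)))"
    and P: "d * P' = (u * P - P1 - x\<^sup>2 * y * u\<^sup>2 * Pd) + d * (x * (y * (a * u)))"
  shows "d * (u * G' - x\<^sup>2 * y * u\<^sup>2 * Gd' - G1' - x\<^sup>2 * y * u\<^sup>2 * G1'' -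
        (1 - z) * x * (x\<^sup>2 * y * u\<^sup>2 * P1' - d * u * P')) =
      u * (u * G - x\<^sup>2 * y * u\<^sup>2 * Gd - G1 - x\<^sup>2 * y * u\<^sup>2 * G1' -
        (1 - z) * x * (x\<^sup>2 * y * u\<^sup>2 * P1 - d * u * P)) +
      d * u\<^sup>2 * a * (x * y * (1 + x * (z + d)))" (is "?l = ?r")
proof -
  \<comment> \<open>\<open>G\<close>, \<open>G1\<close>, \<open>Gd\<close> stand for the series at
    level \<open>k\<close> with weights \<open>u ^ \<tau>\<close>, 1 and \<open>\<tau>\<close>, and
    \<open>P\<close>, \<open>P1\<close>, \<open>Pd\<close> for their peaked analogues; each prime
    raises the level by one, and \<open>a\<close> is \<open>z ^ k\<close>. The two sides differ by a
    multiple of the kernel equation.\<close>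
  have E: "d - x * (y * u\<^sup>2 * (d + x * (1 + d + d\<^sup>2))) = 0" using d by (simp add: u_def)
  have "?l = u * (d * G') - d * (x\<^sup>2 * y * u\<^sup>2 * Gd') - d * G1' - d * (x\<^sup>2 * y * u\<^sup>2 * G1'') -
        (1 - z) * x * (d * (x\<^sup>2 * y * u\<^sup>2 * P1') - d * u * (d * P'))"
    by (simp add: algebra_simps)
  also have "\<dots> = ?r - (d - x * (y * u\<^sup>2 * (d + x * (1 + d + d\<^sup>2)))) * (G1' + (1 - z) * x * u * P1)"
    unfolding G P u_def by (simp add: algebra_simps power2_eq_square power3_eq_cube)
  finally show ?thesis unfolding E by simp
qed

lemma nonempty_series_closed_form:
  fixes y z d :: "'a::idom fps"
  assumes d: "d = fps_X * (y * (1 + d)\<^sup>2 * (d + fps_X * (1 + d + d\<^sup>2)))" and "y \<noteq> 0"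
  shows "fps_X * (1 + d - d * z) * weight_series (\<lambda>e. e \<noteq> []) y z 1 (\<lambda>_. 1) =
    d * (1 + fps_X * (z + d))"
proof -
  define u where "u = 1 + d"
  define x :: "'a fps" where "x = fps_X"
  let ?U = "weight_series (\<lambda>e. e \<noteq> []) y z" and ?P = "weight_series peaked y z"
  note d' = d[folded x_def]
  let ?pow = "\<lambda>\<tau>. u ^ \<tau>" and ?one = "\<lambda>\<tau>::nat. 1 :: 'a fps" and ?of = "\<lambda>\<tau>. of_nat \<tau> :: 'a fps"
  have Q: "\<not> peaked []" by (simp add: peaked_def)
  \<comment> \<open>Linearity in the weight carries the kernel identity over to the series.\<close>
  have kernel: "d * (weight_series R y z k ?pow + x * (y * weight_series R y z k (insertions1 ?pow)) +
      x\<^sup>2 * (y * weight_series R y z k (insertions2 ?pow))) =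
      u * weight_series R y z k ?pow - weight_series R y z k ?one -
      x\<^sup>2 * y * u\<^sup>2 * weight_series R y z k ?of" for R k
  proof -
    have "d * (weight_series R y z k ?pow + x * (y * weight_series R y z k (insertions1 ?pow)) +
        x\<^sup>2 * (y * weight_series R y z k (insertions2 ?pow))) =
      weight_series R y z k (\<lambda>\<tau>. d * (u ^ \<tau> + x * y * insertions1 ?pow \<tau> + x\<^sup>2 * y * insertions2 ?pow \<tau>))"
      by (simp only: weight_series_cmult weight_series_add mult.assoc)
    also have "\<dots> = weight_series R y z k (\<lambda>\<tau>. u * u ^ \<tau> + ((-1) * 1 + (- (x\<^sup>2 * y * u\<^sup>2)) * of_nat \<tau>))"
      unfolding u_def by (subst kernel_identity[OF d']) (simp add: algebra_simps)
    also have "\<dots> = u * weight_series R y z k ?pow - weight_series R y z k ?one -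
        x\<^sup>2 * y * u\<^sup>2 * weight_series R y z k ?of"
      by (simp only: weight_series_add weight_series_cmult) simp
    finally show ?thesis .
  qed
  have const: "weight_series R y z k (\<lambda>_. c) = c * weight_series R y z k ?one" for R k c
    by (rule weight_series_const)
  have Pstep: "d * ?P (Suc k) ?pow =
      (u * ?P k ?pow - ?P k ?one - x\<^sup>2 * y * u\<^sup>2 * ?P k ?of) + d * (x * (y * (z ^ k * u)))" for k
    unfolding kernel[symmetric]
    by (subst weight_series_peaked_Suc) (simp add: x_def algebra_simps)
  have Gstep: "d * ?U (Suc k) ?pow = (u * ?U k ?pow - ?U k ?one - x\<^sup>2 * y * u\<^sup>2 * ?U k ?of) +
      d * (x * (y * (x * ((1 - z) * (u\<^sup>2 * ?P k ?one)) + u * ?U (Suc k) ?one + z ^ k * u)) +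
        x\<^sup>2 * (y * (x * ((1 - z) * (u\<^sup>2 * ?P k ?of + u ^ 3 * ?P k ?one)) +
          (u * ?U (Suc k) ?of - u * ?U (Suc k) ?one + u\<^sup>2 * ?U (Suc k) ?one) +
          x * ((1 - z) * (u * ?P (Suc k) ?one)) + u * ?U (Suc (Suc k)) ?one + z ^ k * z * u\<^sup>2)))" for k
  proof -
    have 1: "?P k (\<lambda>\<tau>. of_nat \<tau> * u ^ 2 + u ^ 3) = u\<^sup>2 * ?P k ?of + u ^ 3 * ?P k ?one"
      using const[of peaked k "u ^ 3"] by (simp only: weight_series_add weight_series_cmult mult.commute[of "of_nat _"])
    have "?U (Suc k) (\<lambda>\<tau>. of_nat (\<tau> - 1) * u ^ 1 + u ^ 2) =
        ?U (Suc k) (\<lambda>\<tau>. u * of_nat \<tau> + (u\<^sup>2 - u) * 1)"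
      by (rule weight_series_cong) (auto simp: algebra_simps of_nat_diff)
    then have 2: "?U (Suc k) (\<lambda>\<tau>. of_nat (\<tau> - 1) * u ^ 1 + u ^ 2) =
        u * ?U (Suc k) ?of - u * ?U (Suc k) ?one + u\<^sup>2 * ?U (Suc k) ?one"
      by (simp only: weight_series_add weight_series_cmult) (simp add: algebra_simps)
    show ?thesis
      unfolding kernel[symmetric] weight_series_nonempty_Suc[of y z k ?pow] 1 2
        const[of _ _ "u ^ 1"] const[of _ _ "u ^ 2"] x_def[symmetric]
      by (simp add: algebra_simps)
  qed
  \<comment> \<open>The first three terms are those of the kernel identity. The series of level
    \<open>k + 1\<close> absorbs the contribution of two leading zeros, and the peaked series absorb
    the rank corrections carrying \<open>1 - z\<close>.\<close>
  define V where "V k = u * ?U k ?pow - x\<^sup>2 * y * u\<^sup>2 * ?U k ?of - ?U k ?one -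
      x\<^sup>2 * y * u\<^sup>2 * ?U (Suc k) ?one -
      (1 - z) * x * (x\<^sup>2 * y * u\<^sup>2 * ?P k ?one - d * u * ?P k ?pow)" for k
  define \<alpha> where "\<alpha> = x * y * (1 + x * (z + d))"
  have Vstep: "d * V (Suc k) = u * V k + d * u\<^sup>2 * z ^ k * \<alpha>" for k
    unfolding V_def \<alpha>_def u_def
    by (rule kernel_step[OF d' Gstep[unfolded u_def] Pstep[unfolded u_def]])
  \<comment> \<open>The inhomogeneous recurrence for \<open>V\<close> has a particular solution
    proportional to \<open>z ^ k\<close>; \<open>T\<close> is the difference from it, multiplied by
    the denominator \<open>u - d * z\<close>.\<close>
  define T where "T k = (u - d * z) * V k + d * u\<^sup>2 * z ^ k * \<alpha>" for k
  have Tstep: "d * T (Suc k) = u * T k" for k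
  proof -
    have "d * T (Suc k) = (u - d * z) * (d * V (Suc k)) + d * d * u\<^sup>2 * z * z ^ k * \<alpha>"
      by (simp add: T_def algebra_simps)
    also have "\<dots> = u * T k" unfolding Vstep T_def by (simp add: algebra_simps)
    finally show ?thesis .
  qed
  have "u ^ k * T 0 = d ^ k * T k" for k
  proof (induction k)
    case (Suc k)
    have "u ^ Suc k * T 0 = d ^ k * (u * T k)" using Suc by (simp add: algebra_simps)
    then show ?case by (simp add: Tstep[symmetric])
  qed simp
  \<comment> \<open>This is the limit in \<open>k\<close>: \<open>d\<close> contains the factor x
    while \<open>u\<close> has constant term 1, so \<open>T 0\<close> is divisible by every power of
    x.\<close>
  then have dvd: "fps_X ^ k dvd u ^ k * T 0" for k
  proof -
    have "fps_X dvd d" using d by (metis dvd_triv_left)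
    then have "fps_X ^ k dvd d ^ k" by (rule dvd_power_same)
    then show ?thesis unfolding \<open>\<And>k. u ^ k * T 0 = d ^ k * T k\<close> by (rule dvd_mult2)
  qed
  have d0: "fps_nth d 0 = 0" by (subst d) simp
  then have u0: "fps_nth u 0 = 1" by (simp add: u_def)
  then have "u \<noteq> 0" by auto
  have "T 0 = 0"
  proof (rule ccontr)
    assume "T 0 \<noteq> 0"
    define n where "n = subdegree (T 0)"
    have "subdegree u = 0" using u0 by (simp add: subdegree_eq_0)
    then have "subdegree (u ^ Suc n * T 0) = n" using \<open>T 0 \<noteq> 0\<close> \<open>u \<noteq> 0\<close> by (simp add: n_def)
    moreover have "u ^ Suc n * T 0 \<noteq> 0" using \<open>T 0 \<noteq> 0\<close> \<open>u \<noteq> 0\<close> by simp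
    ultimately have "fps_nth (u ^ Suc n * T 0) n \<noteq> 0" by (metis nth_subdegree_nonzero)
    then show False using dvd[of "Suc n"] unfolding fps_X_power_dvd_iff by blast
  qed
  \<comment> \<open>All series of level 0 vanish, so the single term of level 1 remains.\<close>
  moreover have "V 0 = - (x\<^sup>2 * y * u\<^sup>2 * ?U 1 ?one)"
    using Q by (simp add: V_def weight_series_0)
  ultimately have "x * y * u\<^sup>2 * (d * (1 + x * (z + d)) - x * (u - d * z) * ?U 1 ?one) = 0"
    by (simp add: T_def \<alpha>_def algebra_simps power2_eq_square)
  moreover have "x * y * u\<^sup>2 \<noteq> 0" using \<open>y \<noteq> 0\<close> \<open>u \<noteq> 0\<close> by (simp add: x_def)
  ultimately have "d * (1 + x * (z + d)) - x * (u - d * z) * ?U 1 ?one = 0" by (metis mult_eq_0_iff)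
  then show ?thesis by (simp add: x_def u_def)
qed

lemma E_series_eq:
  "E_series = 1 + weight_series (\<lambda>e. e \<noteq> []) (fps_const fps_X) (fps_const (fps_const fps_X)) 1 (\<lambda>_. 1)"
    (is "_ = 1 + ?W")
proof (intro fps_ext)
  fix n m t
  let ?y = "fps_const fps_X :: fps3" and ?z = "fps_const (fps_const fps_X) :: fps3"
  let ?c = "\<lambda>e. fps_X ^ card (set e) * fps_const (fps_X ^ shifted_rank 1 e) :: rat fps fps"
  have w: "weight ?y ?z 1 (\<lambda>_. 1) e = fps_const (?c e)" for e
    by (simp add: weight_def flip: fps_const_power fps_const_mult)
  have c: "fps_nth (fps_nth (?c e) m) t = (if card (set e) = m \<and> shifted_rank 1 e = t then 1 else 0)" for e
    by auto
  \<comment> \<open>The weights are free of x, so only sequences of length \<open>n\<close> reach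
    the n-th coefficient.\<close>
  have "fps_nth ?W n = (\<Sum>i\<le>n. if i = n then \<Sum>e\<in>avoiders_of_length 1 n. if e \<noteq> [] then ?c e else 0 else 0)"
    unfolding weight_series_def length_series_def fps_nth_Abs_fps weight_sum_def w
    by (intro sum.cong refl) (auto simp: fps_sum_nth intro!: sum.cong sum.neutral)
  then have "fps_nth (fps_nth (fps_nth ?W n) m) t =
      (\<Sum>e\<in>avoiders_of_length 1 n. if e \<noteq> [] then fps_nth (fps_nth (?c e) m) t else 0)"
    by (simp add: fps_sum_nth if_distrib[of "\<lambda>f. fps_nth (fps_nth f _) _"] cong: if_cong)
  also have "\<dots> = of_nat (card {e \<in> avoiders_of_length 1 n. e \<noteq> [] \<and> card (set e) = m \<and> shifted_rank 1 e = t})"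
    unfolding c by (subst card_eq_sum, subst sum.inter_filter) (auto intro!: sum.cong)
  also have "{e \<in> avoiders_of_length 1 n. e \<noteq> [] \<and> card (set e) = m \<and> shifted_rank 1 e = t} =
      (if n = 0 then {} else IS_102_000 n m t)"
    unfolding IS_102_000_eq by (auto simp: avoiders_of_length_def)
  finally have W: "fps_nth (fps_nth (fps_nth ?W n) m) t =
      of_nat (card (if n = 0 then {} else IS_102_000 n m t))" .
  have E: "fps_nth (fps_nth (fps_nth E_series n) m) t = of_nat (card (IS_102_000 n m t))"
    by (simp add: E_series_def)
  have "[] \<in> avoiders 1" by (simp add: avoiders_def avoids_102_def)
  then have 0: "IS_102_000 0 m t = (if m = 0 \<and> t = 0 then {[]} else {})"
    unfolding IS_102_000_eq by (cases "m = 0 \<and> t = 0") auto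
  show "fps_nth (fps_nth (fps_nth E_series n) m) t = fps_nth (fps_nth (fps_nth (1 + ?W) n) m) t"
    unfolding E fps_add_nth W
  proof (cases "n = 0")
    case True
    show "of_nat (card (IS_102_000 n m t)) = fps_nth (fps_nth (fps_nth 1 n) m) t +
        (of_nat (card (if n = 0 then {} else IS_102_000 n m t)) :: rat)"
      unfolding True 0 by simp
  qed simp
qed

lemma E_series_closed_form:
  obtains d :: fps3 where
    "d = fps_X * (fps_const fps_X * (1 + d)\<^sup>2 * (d + fps_X * (1 + d + d\<^sup>2)))"
    "fps_X * (1 + d - d * fps_const (fps_const fps_X)) * E_series = d + fps_X * (1 + d + d\<^sup>2)"
proof -
  let ?y = "fps_const fps_X :: fps3" and ?z = "fps_const (fps_const fps_X) :: fps3"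
  obtain d where d: "d = fps_X * (?y * (1 + d)\<^sup>2 * (d + fps_X * (1 + d + d\<^sup>2)))"
    using kernel_root_exists[of ?y] by blast
  have "?y \<noteq> 0" by (simp add: fps_const_eq_0_iff)
  from nonempty_series_closed_form[OF d this, of ?z]
  have "fps_X * (1 + d - d * ?z) * (E_series - 1) = d * (1 + fps_X * (?z + d))"
    by (simp add: E_series_eq)
  then have "fps_X * (1 + d - d * ?z) * E_series = d + fps_X * (1 + d + d\<^sup>2)"
    by (simp add: algebra_simps power2_eq_square)
  then show ?thesis using that d by blast
qed

section \<open>The quartic and its minimality\<close>

text \<open>Multiplying by the fourth power of the denominator of \<open>E\<close> turns the quartic
  into a polynomial in \<open>d\<close>, and this polynomial is divisible by the kernel
  polynomial.\<close>

lemma quartic_of_parametrization: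
  fixes x y z d E :: "'a::idom"
  assumes d: "d = x * (y * (1 + d)\<^sup>2 * (d + x * (1 + d + d\<^sup>2)))"
    and E: "x * (1 + d - d * z) * E = d + x * (1 + d + d\<^sup>2)"
    and "x * (1 + d - d * z) \<noteq> 0"
  shows "1 - (1 - 2 * y * x * (1 - x) * z + y * (1 - x)^2 * (1 - z)) * E
    + y * (2 * x^2 * z^2 + x * (1 - x) * (2 * z^2 - 6 * z + 3)
              + y * x^2 * (1 - x)^2 * z^2 + (1 - x)^2 * (1 - z)
              - y * x * (1 - x)^3 * (1 - z)) * E^2
    + y * x * (2 * y * x^2 * (1 - x) * z^3 + x * z * (1 - z) * (4 - z)
              - 2 * y * x * (1 - x)^2 * z * (1 - z) - 2 * (1 - x) * (1 - z)^2) * E^3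
    + y * x^2 * (y * x^2 * z^4 - y * x * (1 - x) * z^2 * (1 - z) + (1 - z)^3) * E^4 = 0"
    (is "1 - ?c1 * E + ?c2 * E^2 + ?c3 * E^3 + ?c4 * E^4 = 0")
proof -
  let ?D = "x * (1 + d - d * z)" and ?N = "d + x * (1 + d + d\<^sup>2)"
  have 1: "(?D * E) = ?N" by (rule E)
  have "?D^4 * (1 - ?c1 * E + ?c2 * E^2 + ?c3 * E^3 + ?c4 * E^4) =
    ?D^4 - ?c1 * (?D * E) * ?D^3 + ?c2 * (?D * E)^2 * ?D^2 + ?c3 * (?D * E)^3 * ?D + ?c4 * (?D * E)^4"
    (is "?D^4 * ?p = _")
  proof -
    have "D^4 * (1 - c1 * E + c2 * E^2 + c3 * E^3 + c4 * E^4) =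
      D^4 - c1 * (D * E) * D^3 + c2 * (D * E)^2 * D^2 + c3 * (D * E)^3 * D + c4 * (D * E)^4"
      for D c1 c2 c3 c4 by algebra
    then show ?thesis .
  qed
  \<comment> \<open>The second factor is the quotient by the kernel polynomial.\<close>
  also have "\<dots> = - (d - x * (y * (1 + d)\<^sup>2 * ?N)) *
      (?D^3 * (1 + x * z + x * d) +
       y * (x * z\<^sup>2 - (1 - x) * (1 - z)) * x\<^sup>2 * ?N * (1 - x + x * z * (1 + d))\<^sup>2)"
    unfolding 1 by algebra
  also have "d - x * (y * (1 + d)\<^sup>2 * ?N) = 0" using d by simp
  finally have "?D^4 * ?p = 0" by simp
  then show ?thesis using assms(3) by (simp only: mult_eq_0_iff power_eq_0_iff) simp
qed

text \<open>Embeds series in x as series free of y. Since x is the outermost variable, the constants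
  sit inside the coefficients; \<open>fps_const a\<close> would instead read the variable of
  \<open>a\<close> as y.\<close>

definition y_const :: "'b::comm_ring_1 fps \<Rightarrow> 'b fps fps" where
  "y_const a = Abs_fps (\<lambda>n. fps_const (fps_nth a n))"

lemma y_const_nth [simp]: "fps_nth (y_const a) n = fps_const (fps_nth a n)"
  by (simp add: y_const_def)

lemma y_const_hom [simp]:
  fixes a b :: "'b::comm_ring_1 fps"
  shows "y_const 0 = (0 :: 'b fps fps)" "y_const 1 = (1 :: 'b fps fps)"
  "y_const (a + b) = y_const a + y_const b" "y_const (a * b) = y_const a * y_const b"
  "y_const (- a) = - y_const a" "y_const (a - b) = y_const a - y_const b"
proof -
  show "y_const 0 = (0 :: 'b fps fps)" "y_const (a + b) = y_const a + y_const b"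
    "y_const (- a) = - y_const a" "y_const (a - b) = y_const a - y_const b"
    by (rule fps_ext; simp)+
  show "y_const 1 = (1 :: 'b fps fps)" by (rule fps_ext) (simp add: fps_one_def)
  have *: "fps_const (sum f A) = (\<Sum>i\<in>A. fps_const (f i))" for f :: "nat \<Rightarrow> 'b" and A
    by (induction A rule: infinite_finite_induct) (simp_all flip: fps_const_add)
  show "y_const (a * b) = y_const a * y_const b"
    by (rule fps_ext) (simp add: fps_mult_nth *)
qed

lemma y_const_numeral [simp]: "y_const (numeral n) = numeral n"
proof -
  have "y_const (of_nat k) = of_nat k" for k by (induction k) simp_all
  from this[of "numeral n"] show ?thesis by simp
qed

lemma y_const_X [simp]: "y_const fps_X = fps_X"
  by (rule fps_ext) simp

lemma y_const_const [simp]: "y_const (fps_const c) = fps_const (fps_const c)"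
  by (rule fps_ext) simp

text \<open>Substitution of \<open>t\<close> into a polynomial whose coefficients are free of y. It
  is used with \<open>t\<close> equal to y, for the coefficients of a relation, and to
  \<open>d\<close>, for the parametrization.\<close>

definition eval_y :: "'b::comm_ring_1 fps fps \<Rightarrow> 'b fps poly \<Rightarrow> 'b fps fps" where
  "eval_y t P = fold_coeffs (\<lambda>a b. y_const a + t * b) P 0"

lemma eval_y_0 [simp]: "eval_y t 0 = 0"
  by (simp add: eval_y_def)

lemma eval_y_pCons [simp]: "eval_y t (pCons a P) = y_const a + t * eval_y t P"
  unfolding eval_y_def by (cases "P = 0 \<and> a = 0") auto

lemma eval_y_add [simp]: "eval_y t (P + Q) = eval_y t P + eval_y t Q"
  by (induction P Q rule: poly_induct2) (simp_all add: algebra_simps)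

lemma eval_y_smult [simp]: "eval_y t (smult a P) = y_const a * eval_y t P"
  by (induction P) (simp_all add: algebra_simps)

lemma eval_y_mult [simp]: "eval_y t (P * Q) = eval_y t P * eval_y t Q"
  by (induction P) (simp_all add: algebra_simps)

lemma eval_y_1 [simp]: "eval_y t 1 = 1"
  by (simp add: one_pCons)

lemma eval_y_uminus [simp]: "eval_y t (- P) = - eval_y t P"
  using eval_y_add[of t P "- P"] by (simp add: eq_neg_iff_add_eq_0 add.commute)

lemma eval_y_diff [simp]: "eval_y t (P - Q) = eval_y t P - eval_y t Q"
  using eval_y_add[of t P "- Q"] by simp

lemma eval_y_power [simp]: "eval_y t (P ^ n) = eval_y t P ^ n"
  by (induction n) simp_all

lemma eval_y_sum [simp]: "eval_y t (sum f A) = (\<Sum>i\<in>A. eval_y t (f i))"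
  by (induction A rule: infinite_finite_induct) simp_all

lemma eval_y_altdef: "degree P \<le> M \<Longrightarrow> eval_y t P = (\<Sum>j\<le>M. y_const (coeff P j) * t ^ j)"
proof -
  assume "degree P \<le> M"
  then have P: "P = (\<Sum>j\<le>M. smult (coeff P j) ([:0, 1:] ^ j))"
    by (intro poly_eqI) (simp add: coeff_sum monom_altdef[of 1, symmetric, simplified] coeff_eq_0 if_distrib cong: if_cong)
  show ?thesis by (subst P) simp
qed

text \<open>Such a \<open>t\<close> is transcendental over the series free of y: setting y to 0
  kills \<open>t\<close> and hence forces the constant coefficient to vanish, after which one factor
  \<open>t\<close> cancels.\<close>

lemma eval_y_inject:
  fixes t :: "'b::idom fps fps"
  assumes "fps_const fps_X dvd t" "t \<noteq> 0" "eval_y t R = 0"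
  shows "R = 0"
  using assms(3)
proof (induction R rule: pCons_induct)
  case (pCons r R)
  obtain s where s: "t = fps_const fps_X * s" using assms(1) by (elim dvdE)
  have "fps_nth r n = 0" for n
  proof -
    have "fps_nth (fps_nth (y_const r + t * eval_y t R) n) 0 = 0" using pCons.prems by simp
    then show ?thesis by (simp add: s mult.assoc)
  qed
  then have "r = 0" by (simp add: fps_eq_iff)
  with pCons.prems have "t * eval_y t R = 0" by simp
  then have "R = 0" using pCons.IH assms(2) by simp
  with \<open>r = 0\<close> show ?case by simp
qed simp

text \<open>A top degree attained only once could not cancel. The degree in \<open>d\<close> is
  minus the order at infinity.\<close>

lemma max_degree_twice:
  fixes t :: "'i \<Rightarrow> 'a::comm_ring_1 poly"
  assumes "finite I" "I \<noteq> {}" "sum t I = 0" "\<And>i. i \<in> I \<Longrightarrow> t i \<noteq> 0"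
  shows "\<exists>i\<in>I. \<exists>j\<in>I. i \<noteq> j \<and> degree (t i) = degree (t j) \<and> (\<forall>k\<in>I. degree (t k) \<le> degree (t i))"
proof -
  let ?m = "Max ((\<lambda>i. degree (t i)) ` I)"
  have "?m \<in> (\<lambda>i. degree (t i)) ` I" using assms by (intro Max_in) auto
  then obtain i where i: "i \<in> I" "degree (t i) = ?m" by (metis imageE)
  have le: "degree (t k) \<le> degree (t i)" if "k \<in> I" for k
    using that assms(1) unfolding i(2) by simp
  have "\<exists>j\<in>I. i \<noteq> j \<and> degree (t i) = degree (t j)"
  proof (rule ccontr)
    assume "\<not> ?thesis"
    then have "coeff (t j) (degree (t i)) = 0" if "j \<in> I - {i}" for j
      using that le[of j] by (intro coeff_eq_0) (metis DiffE insertI1 nat_less_le)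
    then have "coeff (sum t I) (degree (t i)) = lead_coeff (t i)"
      unfolding coeff_sum using assms(1) i(1) by (subst sum.remove[of _ i]) auto
    then show False using assms(3,4) i(1) by simp
  qed
  then show ?thesis using i(1) le by blast
qed

text \<open>\<open>d\<^sup>j S\<^sup>M\<^sup>-\<^sup>j\<close> stands for \<open>S\<^sup>M y\<^sup>j\<close> where \<open>y = d / S\<close>.\<close>

definition homogenize :: "nat \<Rightarrow> 'a::comm_ring_1 poly \<Rightarrow> 'a poly \<Rightarrow> 'a poly" where
  "homogenize M S Q = (\<Sum>j\<le>M. smult (coeff Q j) (monom 1 j * S ^ (M - j)))"

lemma eval_y_homogenize:
  assumes "degree Q \<le> M" "d = y * eval_y d S"
  shows "eval_y d (homogenize M S Q) = eval_y d S ^ M * eval_y y Q"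
proof -
  have "eval_y d (monom 1 j * S ^ (M - j)) = eval_y d S ^ M * y ^ j" if "j \<le> M" for j
  proof -
    have "eval_y d (monom 1 j) = d ^ j"
      using eval_y_power[of d "[:0, 1:]" j] by (simp add: monom_altdef)
    also have "\<dots> = (y * eval_y d S) ^ j" using assms(2) by simp
    finally have "eval_y d (monom 1 j * S ^ (M - j)) = y ^ j * (eval_y d S ^ j * eval_y d S ^ (M - j))"
      by (simp add: power_mult_distrib)
    then show ?thesis using that by (simp flip: power_add)
  qed
  then show ?thesis
    unfolding homogenize_def eval_y_altdef[OF assms(1), of y]
    by (simp add: sum_distrib_left algebra_simps)
qed

text \<open>As S does not vanish at 0, \<open>y = d / S\<close> has a simple zero there, and the
  order in \<open>d\<close> equals the order in y.\<close>

lemma homogenize_order: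
  fixes S :: "'a::idom poly"
  assumes "coeff Q a \<noteq> 0" "\<And>j. j < a \<Longrightarrow> coeff Q j = 0" "a \<le> M" "coeff S 0 \<noteq> 0"
  shows "coeff (homogenize M S Q) a \<noteq> 0" "n < a \<Longrightarrow> coeff (homogenize M S Q) n = 0"
proof -
  have "coeff (homogenize M S Q) n = (\<Sum>j\<le>M. if j = a then
      (if n = a then coeff Q a * coeff S 0 ^ (M - a) else 0) else 0)" if "n \<le> a" for n
    unfolding homogenize_def coeff_sum coeff_smult coeff_monom_mult
    using that assms(2) by (intro sum.cong refl) (auto simp: coeff_0_power not_less)
  then have *: "coeff (homogenize M S Q) n = (if n = a then coeff Q a * coeff S 0 ^ (M - a) else 0)"
    if "n \<le> a" for n
    using that assms(3) by simp
  show "coeff (homogenize M S Q) a \<noteq> 0" using assms by (simp add: *)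
  show "n < a \<Longrightarrow> coeff (homogenize M S Q) n = 0" using * by simp
qed

text \<open>The j-th summand has degree at most \<open>4 * M - 3 * j\<close>, so the lowest nonzero
  coefficient of \<open>Q\<close> decides. The factor 3 is the triple zero of y at infinity.\<close>

lemma homogenize_degree:
  fixes S :: "'a::idom poly"
  assumes "coeff Q a \<noteq> 0" "\<And>j. j < a \<Longrightarrow> coeff Q j = 0" "a \<le> M" "degree S = 4"
  shows "homogenize M S Q \<noteq> 0" "degree (homogenize M S Q) = 4 * M - 3 * a"
proof -
  have S: "S \<noteq> 0" using assms(4) by auto
  then have deg: "degree (monom 1 j * S ^ (M - j)) = j + 4 * (M - j)" for j
    using assms(4) by (subst degree_mult_eq) (auto simp: degree_monom_eq degree_power_eq)
  have "coeff (homogenize M S Q) (4 * M - 3 * a) =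
      (\<Sum>j\<le>M. if j = a then coeff Q a * lead_coeff (monom 1 a * S ^ (M - a)) else 0)"
    unfolding homogenize_def coeff_sum coeff_smult
  proof (intro sum.cong refl)
    fix j assume "j \<in> {..M}"
    consider "j < a" | "j = a" | "a < j" by linarith
    then show "coeff Q j * coeff (monom 1 j * S ^ (M - j)) (4 * M - 3 * a) =
        (if j = a then coeff Q a * lead_coeff (monom 1 a * S ^ (M - a)) else 0)"
    proof cases
      case 2
      then show ?thesis unfolding deg using assms(3) by (simp add: diff_mult_distrib2)
    next
      case 3
      then have "degree (monom 1 j * S ^ (M - j)) < 4 * M - 3 * a"
        unfolding deg using \<open>j \<in> {..M}\<close> assms(3) by auto
      then show ?thesis using 3 by (simp add: coeff_eq_0)
    qed (simp add: assms(2))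
  qed
  also have "\<dots> = coeff Q a * lead_coeff (monom 1 a * S ^ (M - a))" using assms(3) by simp
  finally have nz: "coeff (homogenize M S Q) (4 * M - 3 * a) \<noteq> 0" using assms(1) S by simp
  have "degree (homogenize M S Q) \<le> 4 * M - 3 * a" unfolding homogenize_def
  proof (rule degree_sum_le)
    fix j assume "j \<in> {..M}"
    show "degree (smult (coeff Q j) (monom 1 j * S ^ (M - j))) \<le> 4 * M - 3 * a"
    proof (cases "j < a")
      case False
      have "degree (smult (coeff Q j) (monom 1 j * S ^ (M - j))) \<le> j + 4 * (M - j)"
        using degree_smult_le deg by metis
      then show ?thesis using False \<open>j \<in> {..M}\<close> by simp
    qed (simp add: assms(2))
  qed simp
  with nz show "degree (homogenize M S Q) = 4 * M - 3 * a" by (intro antisym le_degree)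
  show "homogenize M S Q \<noteq> 0" using nz by auto
qed

text \<open>The sum is the relation with coefficients \<open>Q i\<close> for
  \<open>E = N / D\<close>, multiplied by \<open>S ^ M * D ^ 3\<close>. Orders at infinity are read
  off as degrees and orders at 0 as lowest coefficients.\<close>

lemma no_cubic_relation:
  fixes S N D :: "'a::idom poly" and Q :: "nat \<Rightarrow> 'a poly"
  assumes degs: "degree S = 4" "degree N = 2" "degree D = 1"
    and nz: "coeff S 0 \<noteq> 0" "coeff D 0 \<noteq> 0"
    and M: "\<And>i. i \<le> 3 \<Longrightarrow> degree (Q i) \<le> M"
    and sum: "(\<Sum>i\<le>3. homogenize M S (Q i) * N ^ i * D ^ (3 - i)) = 0"
  shows "\<forall>i\<le>3. Q i = 0"
proof (rule ccontr)
  assume not: "\<not> (\<forall>i\<le>3. Q i = 0)"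
  define I where "I = {i. i \<le> 3 \<and> Q i \<noteq> 0}"
  define t where "t i = homogenize M S (Q i) * N ^ i * D ^ (3 - i)" for i
  define a where "a i = (LEAST j. coeff (Q i) j \<noteq> 0)" for i
  have ND: "N \<noteq> 0" "D \<noteq> 0" using degs by auto
  have a: "coeff (Q i) (a i) \<noteq> 0" "\<And>j. j < a i \<Longrightarrow> coeff (Q i) j = 0" "a i \<le> M" if "i \<in> I" for i
  proof -
    have *: "coeff (Q i) (degree (Q i)) \<noteq> 0" using that by (simp add: I_def)
    then show "coeff (Q i) (a i) \<noteq> 0" unfolding a_def by (rule LeastI)
    show "\<And>j. j < a i \<Longrightarrow> coeff (Q i) j = 0" unfolding a_def using not_less_Least by blast
    show "a i \<le> M" using Least_le[of "\<lambda>j. coeff (Q i) j \<noteq> 0", OF *] M[of i] that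
      by (simp add: a_def I_def)
  qed
  have hom_0: "homogenize M S 0 = 0" by (simp add: homogenize_def)
  have "finite I" by (simp add: I_def)
  moreover have "I \<noteq> {}" using not by (auto simp: I_def)
  moreover have "sum t I = 0"
  proof -
    have "sum t I = sum t {..3}" by (rule sum.mono_neutral_left) (auto simp: I_def t_def hom_0)
    then show ?thesis using sum by (simp add: t_def)
  qed
  moreover have t_nz: "t i \<noteq> 0" if "i \<in> I" for i
    using homogenize_degree(1)[OF a[OF that] degs(1)] ND by (simp add: t_def)
  ultimately have "\<exists>i\<in>I. \<exists>j\<in>I. i \<noteq> j \<and> degree (t i) = degree (t j) \<and>
      (\<forall>k\<in>I. degree (t k) \<le> degree (t i))"
    by (rule max_degree_twice)
  then obtain i j where ij: "i \<in> I" "j \<in> I" "i \<noteq> j" "degree (t i) = degree (t j)"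
    "\<forall>k\<in>I. degree (t k) \<le> degree (t i)"
    by blast
  have deg: "degree (t k) + 3 * a k = 4 * M + 3 + k" if "k \<in> I" for k
  proof -
    have "degree (t k) = 4 * M - 3 * a k + 2 * k + (3 - k)"
      unfolding t_def using homogenize_degree[OF a[OF that] degs(1)] ND degs
      by (simp add: degree_mult_eq degree_power_eq)
    then show ?thesis using a(3)[OF that] that by (auto simp: I_def)
  qed
  have "3 * a i + j = 3 * a j + i" using deg[OF ij(1)] deg[OF ij(2)] ij(4) by linarith
  \<comment> \<open>Equal degrees make \<open>i\<close> and \<open>j\<close> congruent modulo 3;
    among distinct indices up to 3 only 0 and 3 qualify. This is where the bound 3 is
    essential.\<close>
  have "(i = 0 \<and> j = 3) \<or> (i = 3 \<and> j = 0)"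
  proof -
    have "i \<le> 3" "j \<le> 3" using ij(1,2) by (simp_all add: I_def)
    then show ?thesis using \<open>3 * a i + j = 3 * a j + i\<close> ij(3) by presburger
  qed
  then have zero: "0 \<in> I" and max: "degree (t k) \<le> degree (t 0)" if "k \<in> I" for k
    using ij that by auto
  \<comment> \<open>Maximality of the degree for index 0 reads
    \<open>3 * a 0 + k \<le> 3 * a k\<close>.\<close>
  have less: "a 0 < a k" if "k \<in> I" "k \<noteq> 0" for k
    using deg[OF that(1)] deg[OF zero[OF that(1)]] max[OF that(1)] that(2) by linarith
  have zero: "0 \<in> I" using zero ij(1) by blast
  have "coeff (t k) (a 0) = 0" if "k \<in> I" "k \<noteq> 0" for k
  proof -
    have "monom 1 (Suc (a 0)) dvd homogenize M S (Q k)"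
      unfolding monom_1_dvd_iff' using homogenize_order(2)[OF a[OF that(1)] nz(1)] less[OF that] by auto
    then have "monom 1 (Suc (a 0)) dvd t k" unfolding t_def by (simp add: mult.assoc)
    then show ?thesis unfolding monom_1_dvd_iff' by simp
  qed
  \<comment> \<open>Now at \<open>d = 0\<close>: every other term has order above
    \<open>a 0\<close>, so nothing cancels the term of index 0.\<close>
  then have "coeff (sum t I) (a 0) = coeff (t 0) (a 0)"
    unfolding coeff_sum using zero \<open>finite I\<close> by (subst sum.remove[of _ 0]) auto
  moreover have "coeff (t 0) (a 0) = coeff (homogenize M S (Q 0)) (a 0) * coeff D 0 ^ 3"
  proof -
    have "coeff (t 0) (a 0) = (\<Sum>n\<le>a 0. coeff (homogenize M S (Q 0)) n * coeff (D ^ 3) (a 0 - n))"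
      by (simp add: t_def coeff_mult)
    also have "\<dots> = (\<Sum>n\<le>a 0. if n = a 0 then coeff (homogenize M S (Q 0)) (a 0) * coeff D 0 ^ 3 else 0)"
      using homogenize_order(2)[OF a[OF zero] nz(1)]
      by (intro sum.cong refl) (auto simp: coeff_0_power)
    finally show ?thesis by simp
  qed
  ultimately show False
    using \<open>sum t I = 0\<close> homogenize_order(1)[OF a[OF zero] nz(1)] nz(2) by simp
qed

section \<open>From the subfield generated by x, y, z to polynomials in y\<close>

lemma fract_of_hom [simp]:
  "fract_of 0 = 0" "fract_of 1 = 1"
  "fract_of (a + b) = fract_of a + fract_of b" "fract_of (a * b) = fract_of a * fract_of b"
  "fract_of (a - b) = fract_of a - fract_of b" "fract_of (- a) = - fract_of a"
  by (simp_all add: fract_of_def Zero_fract_def One_fract_def)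

lemma fract_of_power [simp]: "fract_of (a ^ n) = fract_of a ^ n"
  by (induction n) simp_all

lemma fract_of_sum [simp]: "fract_of (sum f A) = (\<Sum>i\<in>A. fract_of (f i))"
  by (induction A rule: infinite_finite_induct) simp_all

lemma fract_of_eq_0_iff [simp]: "fract_of a = 0 \<longleftrightarrow> a = 0"
  by (simp add: fract_of_def Zero_fract_def eq_fract)

text \<open>Only polynomial dependence on \<open>y\<close> matters below, so power series in \<open>x\<close> and \<open>z\<close> are
  admitted as coefficients.\<close>

lemma subfield_generated_fraction:
  assumes "a \<in> subfield_generated {var_x, var_y, var_z}"
  shows "\<exists>P Q. eval_y (fps_const fps_X) Q \<noteq> 0 \<and>
    fract_of (eval_y (fps_const fps_X) Q) * a = fract_of (eval_y (fps_const fps_X) P)"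
  using assms
proof (induction rule: subfield_generated.induct)
  case (base a)
  then consider "a = var_x" | "a = var_y" | "a = var_z" by blast
  then show ?case
  proof cases
    case 1
    then show ?thesis by (intro exI[of _ "[:fps_X:]"] exI[of _ 1]) (simp add: var_x_def)
  next
    case 2
    then show ?thesis by (intro exI[of _ "[:0, 1:]"] exI[of _ 1]) (simp add: var_y_def)
  next
    case 3
    then show ?thesis by (intro exI[of _ "[:fps_const fps_X:]"] exI[of _ 1]) (simp add: var_z_def)
  qed
next
  case one
  show ?case by (intro exI[of _ 1]) simp
next
  case (diff a b)
  then obtain P Q P' Q' where *: "eval_y (fps_const fps_X) Q \<noteq> 0" "eval_y (fps_const fps_X) Q' \<noteq> 0"
    "fract_of (eval_y (fps_const fps_X) Q) * a = fract_of (eval_y (fps_const fps_X) P)"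
    "fract_of (eval_y (fps_const fps_X) Q') * b = fract_of (eval_y (fps_const fps_X) P')"
    by blast
  then show ?case
    by (intro exI[of _ "P * Q' - P' * Q"] exI[of _ "Q * Q'"]) (simp flip: *(3,4) add: algebra_simps)
next
  case (mult a b)
  then obtain P Q P' Q' where *: "eval_y (fps_const fps_X) Q \<noteq> 0" "eval_y (fps_const fps_X) Q' \<noteq> 0"
    "fract_of (eval_y (fps_const fps_X) Q) * a = fract_of (eval_y (fps_const fps_X) P)"
    "fract_of (eval_y (fps_const fps_X) Q') * b = fract_of (eval_y (fps_const fps_X) P')"
    by blast
  then show ?case
    by (intro exI[of _ "P * P'"] exI[of _ "Q * Q'"]) (simp flip: *(3,4))
next
  case (inverse a)
  then obtain P Q where *: "eval_y (fps_const fps_X) Q \<noteq> 0"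
    "fract_of (eval_y (fps_const fps_X) Q) * a = fract_of (eval_y (fps_const fps_X) P)"
    by blast
  show ?case
  proof (cases "a = 0")
    case True
    then show ?thesis by (intro exI[of _ 0] exI[of _ 1]) simp
  next
    case False
    with * have "eval_y (fps_const fps_X) P \<noteq> 0" by (metis fract_of_eq_0_iff mult_eq_0_iff)
    moreover have "fract_of (eval_y (fps_const fps_X) P) * inverse a =
        fract_of (eval_y (fps_const fps_X) Q)"
      unfolding *(2)[symmetric] using False by (simp add: mult.assoc)
    ultimately show ?thesis by blast
  qed
qed

text \<open>The last conjunct carries the induction: the old denominator becomes a factor of the new
  numerator, which has to stay polynomial in y.\<close>

lemma common_denominator:
  fixes n :: nat
  assumes "\<And>i. a i \<in> subfield_generated {var_x, var_y, var_z}"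
  shows "\<exists>b P. b \<noteq> 0 \<and> (\<forall>i<n. fract_of b * a i = fract_of (eval_y (fps_const fps_X) (P i))) \<and>
    (\<exists>B. b = eval_y (fps_const fps_X) B)"
proof (induction n)
  case 0
  show ?case by (intro exI[of _ 1]) (auto intro: exI[of _ 1])
next
  case (Suc n)
  then obtain B P where *: "eval_y (fps_const fps_X) B \<noteq> 0"
    "\<And>i. i < n \<Longrightarrow> fract_of (eval_y (fps_const fps_X) B) * a i = fract_of (eval_y (fps_const fps_X) (P i))"
    by blast
  obtain R Q where RQ: "eval_y (fps_const fps_X) Q \<noteq> 0"
    "fract_of (eval_y (fps_const fps_X) Q) * a n = fract_of (eval_y (fps_const fps_X) R)"
    using subfield_generated_fraction[OF assms] by blast
  have "fract_of (eval_y (fps_const fps_X) (B * Q)) * a i =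
      fract_of (eval_y (fps_const fps_X) (if i = n then B * R else P i * Q))" if "i < Suc n" for i
    using that RQ(2) *(2)[of i] by (cases "i = n") (simp_all add: mult.assoc mult.left_commute)
  moreover have "eval_y (fps_const fps_X) (B * Q) \<noteq> 0" using * RQ by simp
  ultimately show ?case
    by (intro exI[of _ "eval_y (fps_const fps_X) (B * Q)"] exI[of _ "\<lambda>i. if i = n then B * R else P i * Q"]) blast
qed

lemma E_series_no_cubic_relation:
  assumes "(\<Sum>i\<le>3. eval_y (fps_const fps_X) (Q i) * E_series ^ i) = 0"
  shows "\<forall>i\<le>3. Q i = 0"
proof -
  let ?y = "fps_const fps_X :: fps3"
  obtain d :: fps3 where
    d: "d = fps_X * (?y * (1 + d)\<^sup>2 * (d + fps_X * (1 + d + d\<^sup>2)))" and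
    E: "fps_X * (1 + d - d * fps_const (fps_const fps_X)) * E_series = d + fps_X * (1 + d + d\<^sup>2)"
    by (rule E_series_closed_form)
  let ?x = "fps_X :: rat fps fps" and ?z = "fps_const fps_X :: rat fps fps"
  \<comment> \<open>In the variable \<open>d\<close> the closed form reads \<open>E = N / D\<close>,
    and the kernel equation reads \<open>y = d / S\<close>. The degrees 2, 1 and 4 produce the pole
    of E and the zero of y at infinity.\<close>
  define N where "N = [:?x, 1 + ?x, ?x:]"
  define D where "D = [:?x, ?x * (1 - ?z):]"
  define S where "S = [:?x:] * [:1, 1:]\<^sup>2 * N"
  have ev: "eval_y d N = d + fps_X * (1 + d + d\<^sup>2)"
    "eval_y d D = fps_X * (1 + d - d * fps_const (fps_const fps_X))"
    "eval_y d S = fps_X * (1 + d)\<^sup>2 * (d + fps_X * (1 + d + d\<^sup>2))"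
    by (simp_all add: N_def D_def S_def algebra_simps power2_eq_square)
  have dS: "d = ?y * eval_y d S" unfolding ev by (subst d) (simp add: algebra_simps)
  \<comment> \<open>The leading coefficient of \<open>D\<close> contains
    \<open>1 - z\<close>.\<close>
  have z1: "1 - ?z \<noteq> 0"
  proof
    assume "1 - ?z = 0"
    then have "fps_nth (fps_nth (1 - ?z) 0) 0 = 0" by simp
    then show False by simp
  qed
  have degs: "degree N = 2" "degree D = 1" using z1 by (simp_all add: N_def D_def)
  then have degS: "degree S = 4"
    unfolding S_def by (subst degree_mult_eq; simp add: degree_mult_eq degree_power_eq N_def)
  have nz: "coeff S 0 \<noteq> 0" "coeff D 0 \<noteq> 0"
    by (simp_all add: S_def N_def D_def coeff_mult_0 power2_eq_square)
  have "d \<noteq> 0"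
  proof
    assume "d = 0"
    then have "eval_y 0 S = 0" using dS by simp
    then show False by (simp add: S_def N_def power2_eq_square)
  qed
  define M where "M = Max ((\<lambda>i. degree (Q i)) ` {..3})"
  have M: "degree (Q i) \<le> M" if "i \<le> 3" for i using that by (simp add: M_def)
  \<comment> \<open>Clearing denominators multiplies the relation by the values of
    \<open>S ^ M\<close> and \<open>D ^ 3\<close> at \<open>d\<close>.\<close>
  have "eval_y d (\<Sum>i\<le>3. homogenize M S (Q i) * N ^ i * D ^ (3 - i)) =
      (\<Sum>i\<le>3. (eval_y d S ^ M * eval_y ?y (Q i)) * (eval_y d D * E_series) ^ i * eval_y d D ^ (3 - i))"
    using E by (simp add: eval_y_homogenize[OF M dS] flip: ev)
  also have "\<dots> = (\<Sum>i\<le>3. eval_y d S ^ M * eval_y d D ^ 3 * (eval_y ?y (Q i) * E_series ^ i))"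
  proof (intro sum.cong refl)
    fix i :: nat assume "i \<in> {..3}"
    then have "eval_y d D ^ 3 = eval_y d D ^ i * eval_y d D ^ (3 - i)" by (simp flip: power_add)
    then show "(eval_y d S ^ M * eval_y ?y (Q i)) * (eval_y d D * E_series) ^ i * eval_y d D ^ (3 - i) =
      eval_y d S ^ M * eval_y d D ^ 3 * (eval_y ?y (Q i) * E_series ^ i)"
      by (simp add: power_mult_distrib algebra_simps)
  qed
  also have "\<dots> = 0" using assms by (simp flip: sum_distrib_left)
  \<comment> \<open>As \<open>d\<close> is nonzero and divisible by y, the relation between series
    lifts to an identity of polynomials.\<close>
  finally have "(\<Sum>i\<le>3. homogenize M S (Q i) * N ^ i * D ^ (3 - i)) = 0"
    using dS \<open>d \<noteq> 0\<close> by (intro eval_y_inject[of d]) (metis dvd_triv_left)+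
  then show ?thesis using no_cubic_relation[OF degS degs nz, of Q M] M by blast
qed

lemma E_series_degree_ge_4:
  assumes "q \<in> annihilating_polys (subfield_generated {var_x, var_y, var_z}) (fract_of E_series)"
  shows "4 \<le> degree q"
proof (rule ccontr)
  assume "\<not> 4 \<le> degree q"
  then have deg: "degree q \<le> 3" by simp
  have q: "q \<noteq> 0" "\<And>i. coeff q i \<in> subfield_generated {var_x, var_y, var_z}"
    "poly q (fract_of E_series) = 0"
    using assms by (auto simp: annihilating_polys_def)
  obtain b P where b: "b \<noteq> 0"
    "\<forall>i<4. fract_of b * coeff q i = fract_of (eval_y (fps_const fps_X) (P i))"
    using common_denominator[of "coeff q" 4, OF q(2)] by blast
  have "fract_of (\<Sum>i\<le>3. eval_y (fps_const fps_X) (P i) * E_series ^ i) =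
      (\<Sum>i\<le>3. fract_of b * (coeff q i * fract_of E_series ^ i))"
    using b(2) by (simp add: mult.assoc[symmetric])
  also have "\<dots> = fract_of b * poly q (fract_of E_series)"
    unfolding sum_distrib_left[symmetric] poly_altdef using deg
    by (subst sum.mono_neutral_right[of "{..3}" "{..degree q}"]) (auto simp: coeff_eq_0)
  finally have "(\<Sum>i\<le>3. eval_y (fps_const fps_X) (P i) * E_series ^ i) = 0"
    unfolding q(3) mult_zero_right fract_of_eq_0_iff .
  then have "\<forall>i\<le>3. P i = 0" by (rule E_series_no_cubic_relation)
  have "coeff q i = 0" if "i \<le> 3" for i
  proof -
    have "i < 4" using that by simp
    then have "fract_of b * coeff q i = 0" using b(2) \<open>\<forall>i\<le>3. P i = 0\<close> that by simp
    then show ?thesis using b(1) by simp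
  qed
  then have "coeff q (degree q) = 0" using deg by blast
  then show False using q(1) by simp
qed

section \<open>Closure properties of generated subfields and the final assembly\<close>

lemma subfield_generated_add:
  assumes "a \<in> subfield_generated S" "b \<in> subfield_generated S"
  shows "a + b \<in> subfield_generated S"
proof -
  have "0 \<in> subfield_generated S" using subfield_generated.diff[OF assms(1,1)] by simp
  then have "0 - b \<in> subfield_generated S" using assms(2) by (rule subfield_generated.diff)
  then have "a - (0 - b) \<in> subfield_generated S" by (rule subfield_generated.diff[OF assms(1)])
  then show ?thesis by simp
qed

lemma zero_in_subfield_generated: "0 \<in> subfield_generated S"
  using subfield_generated.diff[OF subfield_generated.one subfield_generated.one] by simp

lemma uminus_in_subfield_generated: "a \<in> subfield_generated S \<Longrightarrow> - a \<in> subfield_generated S"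
  using subfield_generated.diff[OF zero_in_subfield_generated] by fastforce

lemma power_in_subfield_generated: "a \<in> subfield_generated S \<Longrightarrow> a ^ n \<in> subfield_generated S"
  by (induction n) (auto intro: subfield_generated.one subfield_generated.mult)

lemma numeral_in_subfield_generated: "numeral n \<in> subfield_generated S"
proof -
  have "of_nat k \<in> subfield_generated S" for k
    by (induction k) (auto intro: zero_in_subfield_generated subfield_generated.one subfield_generated_add)
  from this[of "numeral n"] show ?thesis by simp
qed

lemma coeff_pCons_in_iff:
  "(\<forall>i. coeff (pCons a p) i \<in> K) \<longleftrightarrow> a \<in> K \<and> (\<forall>i. coeff p i \<in> K)"
  by (auto simp: coeff_pCons split: nat.splits)

theorem theorem4p3:
  fixes x y z :: "fps3 fract" and K :: "fps3 fract set" and E :: "fps3 fract"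
  assumes "x = var_x" and "y = var_y" and "z = var_z"
    and "K = subfield_generated {x, y, z}"
    and "E = fract_of E_series"
  shows "algebraic_over K E \<and>
    is_minimal_poly K E
      [: 1,
         - (1 - 2 * y * x * (1 - x) * z + y * (1 - x)^2 * (1 - z)),
         y * (2 * x^2 * z^2 + x * (1 - x) * (2 * z^2 - 6 * z + 3)
              + y * x^2 * (1 - x)^2 * z^2 + (1 - x)^2 * (1 - z)
              - y * x * (1 - x)^3 * (1 - z)),
         y * x * (2 * y * x^2 * (1 - x) * z^3 + x * z * (1 - z) * (4 - z)
              - 2 * y * x * (1 - x)^2 * z * (1 - z) - 2 * (1 - x) * (1 - z)^2),
         y * x^2 * (y * x^2 * z^4 - y * x * (1 - x) * z^2 * (1 - z) + (1 - z)^3) :]"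
proof -
  define c1 where "c1 = 1 - 2 * y * x * (1 - x) * z + y * (1 - x)^2 * (1 - z)"
  define c2 where "c2 = y * (2 * x^2 * z^2 + x * (1 - x) * (2 * z^2 - 6 * z + 3)
              + y * x^2 * (1 - x)^2 * z^2 + (1 - x)^2 * (1 - z)
              - y * x * (1 - x)^3 * (1 - z))"
  define c3 where "c3 = y * x * (2 * y * x^2 * (1 - x) * z^3 + x * z * (1 - z) * (4 - z)
              - 2 * y * x * (1 - x)^2 * z * (1 - z) - 2 * (1 - x) * (1 - z)^2)"
  define c4 where "c4 = y * x^2 * (y * x^2 * z^4 - y * x * (1 - x) * z^2 * (1 - z) + (1 - z)^3)"
  let ?p = "[:1, - c1, c2, c3, c4:]"
  obtain d :: fps3 where
    d: "d = fps_X * (fps_const fps_X * (1 + d)\<^sup>2 * (d + fps_X * (1 + d + d\<^sup>2)))" and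
    E: "fps_X * (1 + d - d * fps_const (fps_const fps_X)) * E_series = d + fps_X * (1 + d + d\<^sup>2)"
    by (rule E_series_closed_form)
  have "poly ?p E = 0"
  proof -
    let ?d = "fract_of d"
    have "?d = x * (y * (1 + ?d)\<^sup>2 * (?d + x * (1 + ?d + ?d\<^sup>2)))"
      using arg_cong[OF d, of fract_of] unfolding assms var_x_def var_y_def by simp
    moreover have "x * (1 + ?d - ?d * z) * E = ?d + x * (1 + ?d + ?d\<^sup>2)"
      using arg_cong[OF E, of fract_of] unfolding assms var_x_def var_z_def by simp
    moreover have "x * (1 + ?d - ?d * z) \<noteq> 0"
    proof -
      have "fps_nth d 0 = 0" by (subst d) simp
      then have "fps_nth (1 + d - d * fps_const (fps_const fps_X)) 0 = 1" by simp
      then have "1 + d - d * fps_const (fps_const fps_X) \<noteq> 0" by (metis fps_zero_nth zero_neq_one)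
      then have "fract_of (fps_X * (1 + d - d * fps_const (fps_const fps_X))) \<noteq> 0"
        unfolding fract_of_eq_0_iff by simp
      then show ?thesis unfolding assms var_x_def var_z_def by simp
    qed
    ultimately have "1 - c1 * E + c2 * E^2 + c3 * E^3 + c4 * E^4 = 0"
      unfolding c1_def c2_def c3_def c4_def by (rule quartic_of_parametrization)
    then show ?thesis by (simp add: algebra_simps power2_eq_square power3_eq_cube power4_eq_xxxx)
  qed
  moreover have "\<forall>i. coeff ?p i \<in> K"
  proof -
    have "x \<in> K" "y \<in> K" "z \<in> K" unfolding assms(4) by (auto intro: subfield_generated.base)
    then show ?thesis
      unfolding assms(4) coeff_pCons_in_iff c1_def c2_def c3_def c4_def
      by (intro conjI allI subfield_generated_add subfield_generated.mult subfield_generated.diff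
          subfield_generated.one power_in_subfield_generated numeral_in_subfield_generated
          uminus_in_subfield_generated; simp add: zero_in_subfield_generated)
  qed
  ultimately have ann: "?p \<in> annihilating_polys K E" by (simp add: annihilating_polys_def)
  moreover have "degree ?p \<le> degree q" if "q \<in> annihilating_polys K E" for q
  proof -
    have "degree ?p \<le> 4" by (intro degree_le) (auto simp: coeff_pCons split: nat.splits)
    also have "4 \<le> degree q" using that E_series_degree_ge_4 unfolding assms by blast
    finally show ?thesis .
  qed
  ultimately have "algebraic_over K E \<and> is_minimal_poly K E ?p"
    unfolding algebraic_over_def is_minimal_poly_def by blast
  then show ?thesis unfolding c1_def c2_def c3_def c4_def .
qed

end
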